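(* Let $G$ be a compact connected Abelian topological group, equipped with normalized Haar measure $\mu$ (so $\mu(G)=1$). For any measurable subsets $A,B,C\subset G$, $$\int_C \mathbf 1_A*\mathbf 1_B\,d\mu \;\le\; \int_{C^\star} \mathbf 1_{A^\star}*\mathbf 1_{B^\star}\,dm .$$
   Context: Haar measure $\mu$ is assumed complete; measurable means $\mu$-measurable. $\mathbb T=\mathbb R/\mathbb Z$ carries Lebesgue measure $m$ with $m(\mathbb T)=1$. $\mathbf 1_E$ is the indicator function of $E$. Convolution on $G$ is $f*g(x)=\int_G f(x-y)g(y)\,d\mu(y)$, and likewise on $\mathbb T$ with respect to $m$. For measurable $A\subset G$, $A^\star\subset\mathbb T$ is the closed interval centered at $0$ with $m(A^\star)=\mu(A)$. *)

theory Defs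
  imports "HOL-Analysis.Analysis"
begin

text \<open>
  A Haar measure is the completion of a nonzero translation-invariant Radon measure on the Borel
  sets. Regularity has to be required separately, since the group need not be second countable.
\<close>

definition radon_measure :: "'a::topological_space measure \<Rightarrow> bool" where
  "radon_measure \<nu> \<longleftrightarrow>
     sets \<nu> = sets borel \<and>
     (\<forall>K. compact K \<longrightarrow> emeasure \<nu> K < \<infinity>) \<and>
     (\<forall>E\<in>sets borel. emeasure \<nu> E = (INF U\<in>{U. open U \<and> E \<subseteq> U}. emeasure \<nu> U)) \<and>
     (\<forall>U. open U \<longrightarrow> emeasure \<nu> U = (SUP K\<in>{K. compact K \<and> K \<subseteq> U}. emeasure \<nu> K))"

definition haar_measure :: "'a::topological_ab_group_add measure \<Rightarrow> bool" where
  "haar_measure \<mu> \<longleftrightarrow>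
     (\<exists>\<nu>. radon_measure \<nu> \<and> emeasure \<nu> UNIV \<noteq> 0 \<and>
          (\<forall>x. \<forall>E\<in>sets borel. emeasure \<nu> ((+) x ` E) = emeasure \<nu> E) \<and>
          \<mu> = completion \<nu>)"

definition convolution ::
    "'a::ab_group_add measure \<Rightarrow> ('a \<Rightarrow> real) \<Rightarrow> ('a \<Rightarrow> real) \<Rightarrow> 'a \<Rightarrow> real" where
  "convolution M f g x = (LINT y|M. f (x - y) * g y)"

definition int_cong :: "real \<Rightarrow> real \<Rightarrow> bool" where
  "int_cong x y \<longleftrightarrow> x - y \<in> \<int>"

lemma equivp_int_cong: "equivp int_cong"
proof (rule equivpI)
  show "reflp int_cong" by (auto simp: reflp_def int_cong_def)
  show "symp int_cong"
    unfolding symp_def int_cong_def by (metis Ints_minus minus_diff_eq)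
  show "transp int_cong"
    unfolding transp_def int_cong_def by (metis Ints_add diff_add_cancel add_diff_eq)
qed

quotient_type circle = real / int_cong
  morphisms rep_circle to_circle
  by (rule equivp_int_cong)

instantiation circle :: ab_group_add
begin

lift_definition zero_circle :: circle is 0 .

lift_definition plus_circle :: "circle \<Rightarrow> circle \<Rightarrow> circle" is "(+)"
  unfolding int_cong_def by (metis Ints_add add_diff_add)

lift_definition uminus_circle :: "circle \<Rightarrow> circle" is uminus
  unfolding int_cong_def by (metis Ints_minus minus_diff_minus)

lift_definition minus_circle :: "circle \<Rightarrow> circle \<Rightarrow> circle" is "(-)"
  unfolding int_cong_def
proof -
  fix a b c d :: real
  assume "a - b \<in> \<int>" "c - d \<in> \<int>"
  then have "(a - b) - (c - d) \<in> \<int>" by (rule Ints_diff)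
  then show "a - c - (b - d) \<in> \<int>" by (simp add: algebra_simps)
qed

instance
  by standard (transfer; simp add: int_cong_def)+

end

lemma to_circle_eq_iff: "to_circle x = to_circle y \<longleftrightarrow> x - y \<in> \<int>"
  by (metis circle.abs_eq_iff int_cong_def)

text \<open>
  The complete Lebesgue measure on the circle: its measurable sets are those with Lebesgue
  measurable preimage in the reals, and its mass is read off on the fundamental domain.
\<close>

definition circle_measure :: "circle measure" where
  "circle_measure =
     distr (lebesgue_on {0..<1}) (sigma UNIV {E. to_circle -` E \<in> sets lebesgue}) to_circle"

text \<open>
  The closed interval centered at 0 of measure \<open>measure M A\<close>; for a null set it is the single point 0.
\<close>

definition rearrangement :: "'a measure \<Rightarrow> 'a set \<Rightarrow> circle set" where
  "rearrangement M A = to_circle ` {- measure M A / 2 .. measure M A / 2}"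

lemma space_circle_measure [simp]: "space circle_measure = UNIV"
  by (simp add: circle_measure_def space_measure_of_conv)

lemma sigma_algebra_circle: "sigma_algebra UNIV {E. to_circle -` E \<in> sets lebesgue}"
proof -
  have "to_circle -` (UNIV - E) \<in> sets lebesgue" if "to_circle -` E \<in> sets lebesgue" for E
    using sets.compl_sets[OF that] by (simp add: vimage_Diff)
  then show ?thesis
    unfolding sigma_algebra_iff2 by (auto simp: vimage_UN)
qed

lemma sets_circle_measure: "E \<in> sets circle_measure \<longleftrightarrow> to_circle -` E \<in> sets lebesgue"
  unfolding circle_measure_def
  by (simp add: sigma_algebra.sets_measure_of_eq[OF sigma_algebra_circle])

lemma emeasure_circle_measure:
  assumes "to_circle -` E \<in> sets lebesgue"
  shows "emeasure circle_measure E = emeasure lebesgue (to_circle -` E \<inter> {0..<1})"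
proof -
  let ?S = "sigma UNIV {E. to_circle -` E \<in> sets lebesgue}"
  have S: "sets ?S = {E. to_circle -` E \<in> sets lebesgue}"
    by (rule sigma_algebra.sets_measure_of_eq[OF sigma_algebra_circle])
  have "to_circle \<in> measurable (lebesgue_on {0..<1}) ?S"
    by (rule measurableI) (auto simp: S sets_restrict_space space_measure_of_conv Int_commute)
  then show ?thesis
    unfolding circle_measure_def using assms
    by (subst emeasure_distr) (auto simp: S emeasure_restrict_space)
qed

lemma emeasure_circle_UNIV: "emeasure circle_measure UNIV = 1"
  by (subst emeasure_circle_measure) auto

lemma emeasure_rearrangement:
  assumes "emeasure M (space M) = 1" "A \<in> sets M"
  shows "rearrangement M A \<in> sets circle_measure"
    and "emeasure circle_measure (rearrangement M A) = emeasure M A"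
proof -
  interpret M: finite_measure M
    by standard (use assms(1) in simp)
  define a where "a = measure M A"
  have a: "0 \<le> a" "a \<le> 1" "emeasure M A = ennreal a"
  proof -
    show "0 \<le> a" by (simp add: a_def)
    show e: "emeasure M A = ennreal a"
      by (simp add: a_def M.emeasure_eq_measure)
    have "emeasure M A \<le> 1" using emeasure_space[of M A] assms(1) by simp
    then show "a \<le> 1" using e by (simp add: ennreal_le_1)
  qed
  have v: "to_circle -` rearrangement M A = (\<Union>k::int. {of_int k - a/2 .. of_int k + a/2})"
  proof (rule set_eqI)
    fix x
    have "x \<in> to_circle -` rearrangement M A \<longleftrightarrow> (\<exists>y\<in>{-a/2..a/2}. x - y \<in> \<int>)"
      by (auto simp: rearrangement_def a_def[symmetric] to_circle_eq_iff)
    also have "\<dots> \<longleftrightarrow> (\<exists>k::int. x - of_int k \<in> {-a/2..a/2})"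
    proof
      assume "\<exists>y\<in>{-a/2..a/2}. x - y \<in> \<int>"
      then obtain y k where "y \<in> {-a/2..a/2}" "x - y = of_int k" by (auto elim!: Ints_cases)
      then have "x - of_int k \<in> {-a/2..a/2}" by (simp add: algebra_simps)
      then show "\<exists>k::int. x - of_int k \<in> {-a/2..a/2}" ..
    next
      assume "\<exists>k::int. x - of_int k \<in> {-a/2..a/2}"
      then show "\<exists>y\<in>{-a/2..a/2}. x - y \<in> \<int>" by (auto intro!: bexI[of _ "x - of_int _"])
    qed
    also have "\<dots> \<longleftrightarrow> x \<in> (\<Union>k::int. {of_int k - a/2 .. of_int k + a/2})"
      by (auto simp: algebra_simps)
    finally show "x \<in> to_circle -` rearrangement M A \<longleftrightarrow> x \<in> (\<Union>k::int. {of_int k - a/2 .. of_int k + a/2})" .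
  qed
  have m: "to_circle -` rearrangement M A \<in> sets lebesgue"
    unfolding v by (intro sets.countable_UN') auto
  then show "rearrangement M A \<in> sets circle_measure" by (simp add: sets_circle_measure)
  have i: "to_circle -` rearrangement M A \<inter> {0..<1} = {0..a/2} \<inter> {0..<1} \<union> {1 - a/2..<1} \<inter> {0..<1}"
  proof (rule set_eqI)
    fix x :: real
    have k: "k = 0 \<or> k = 1"
      if "of_int k - a/2 \<le> x" "x \<le> of_int k + a/2" "0 \<le> x" "x < 1" for k :: int
    proof -
      have "real_of_int k < 2" "-1 < real_of_int k" using that a by linarith+
      then show ?thesis by linarith
    qed
    show "x \<in> to_circle -` rearrangement M A \<inter> {0..<1} \<longleftrightarrow>
        x \<in> {0..a/2} \<inter> {0..<1} \<union> {1 - a/2..<1} \<inter> {0..<1}" (is "?L \<longleftrightarrow> ?R")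
    proof
      assume ?L
      then obtain k :: int where
        "of_int k - a/2 \<le> x" "x \<le> of_int k + a/2" "0 \<le> x" "x < 1"
        unfolding v by auto
      with k[of k] show ?R by auto
    next
      assume R: ?R
      then have "x \<in> {of_int 0 - a/2 .. of_int 0 + a/2} \<or> x \<in> {of_int 1 - a/2 .. of_int 1 + a/2}"
        using a by auto
      then have "x \<in> (\<Union>k::int. {of_int k - a/2 .. of_int k + a/2})" by blast
      then show ?L using R unfolding v by auto
    qed
  qed
  have j: "{0..a/2} \<inter> {0..<1} \<union> {1 - a/2..<1} \<inter> {0..<1} = {0..a/2} \<union> {1 - a/2..<1}"
    using a by auto
  have "emeasure lebesgue ({0..a/2} \<union> {1 - a/2..<1}) = ennreal a"
  proof (cases "a = 1")
    case True
    then have "{0..a/2} \<union> {1 - a/2..<1} = {0..<1::real}" by auto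
    then show ?thesis using True by simp
  next
    case False
    then have "{0..a/2} \<inter> {1 - a/2..<1} = {}" using a by auto
    then have "emeasure lebesgue ({0..a/2} \<union> {1 - a/2..<1})
        = emeasure lebesgue {0..a/2} + emeasure lebesgue {1 - a/2..<1}"
      by (intro plus_emeasure[symmetric]) auto
    also have "\<dots> = ennreal (a/2) + ennreal (a/2)" using a by simp
    also have "\<dots> = ennreal a" using a by (simp flip: ennreal_plus)
    finally show ?thesis .
  qed
  then show "emeasure circle_measure (rearrangement M A) = emeasure M A"
    by (simp only: emeasure_circle_measure[OF m] i j a(3))
qed

end

theory Submission
  imports Defs "HOL-Probability.Probability_Measure"
begin

text \<open>
  Following Tao and Ruzsa, fix \<open>B\<close> and \<open>0 < t < \<mu>(B)\<close> and put
  \<open>F(A) = \<integral> min (1\<^sub>A * 1\<^sub>B, t) - t \<mu>(A)\<close>. Concavity of \<open>min (\<cdot>, t)\<close> makes \<open>F\<close> submodular,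
  and \<open>F\<close> is translation invariant, so \<open>F(A \<inter> (x + A)) + F(A \<union> (x + A)) \<le> 2 F(A)\<close>. The continuous
  function \<open>x \<mapsto> \<mu>(A \<inter> (x + A))\<close> has mean \<open>\<mu>(A)\<^sup>2\<close> and value \<open>\<mu>(A)\<close> at 0; as the group is
  connected it takes all values in between. Hence the infimum of \<open>F\<close> over sets of given measure is
  a concave function of the measure. It equals \<open>t (\<mu>(B) - t)\<close> at the measures \<open>t\<close> and
  \<open>1 - \<mu>(B) + t\<close>, so \<open>\<integral> min (1\<^sub>A * 1\<^sub>B, t) \<ge> t (\<mu>(A) + \<mu>(B) - t)\<close> for \<open>A\<close> with measure between
  these. With \<open>2 t = \<mu>(A) + \<mu>(B) - \<mu>(C)\<close> and
  \<open>\<integral>\<^bsub>C\<^esub> 1\<^sub>A * 1\<^sub>B \<le> t \<mu>(C) + \<integral> (1\<^sub>A * 1\<^sub>B - min (1\<^sub>A * 1\<^sub>B, t))\<close> this is the value on the circle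
  in the only case in which the trivial bounds do not already give it.
\<close>

section \<open>Regular invariant measures on compact groups\<close>

text \<open>This is the Borel measure before completion. Regularity enters as outer regularity,
  which complements turn into inner regularity because closed sets are compact here.\<close>

locale compact_group_measure = prob_space M
  for M :: "'a::{topological_ab_group_add, t2_space} measure" +
  assumes compact_UNIV: "compact (UNIV :: 'a set)"
    and sets_M [measurable_cong, simp]: "sets M = sets borel"
    and emeasure_translate: "E \<in> sets borel \<Longrightarrow> emeasure M ((+) x ` E) = emeasure M E"
    and outer_regular: "E \<in> sets borel \<Longrightarrow>
      emeasure M E = (INF U\<in>{U. open U \<and> E \<subseteq> U}. emeasure M U)"
begin

lemma space_M [simp]: "space M = UNIV"
  using sets_eq_imp_space_eq[OF sets_M] by simp

section \<open>Translates and reflections of sets\<close>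

lemma image_plus_eq_vimage: "(+) x ` E = (\<lambda>y. y - x) -` E" for x :: 'a
  by (auto simp: image_iff) (metis add.commute diff_add_cancel)

lemma image_uminus_eq_vimage: "uminus ` E = uminus -` E" for E :: "'a set"
  by (auto simp: image_iff) (metis minus_minus)

lemma borel_translate [simp]: "E \<in> sets borel \<Longrightarrow> (+) x ` E \<in> sets borel" for x :: 'a
  unfolding image_plus_eq_vimage
  by (rule measurable_sets_borel[of _ borel], intro borel_measurable_continuous_onI continuous_intros)

lemma borel_uminus [simp]: "E \<in> sets borel \<Longrightarrow> uminus ` E \<in> sets borel" for E :: "'a set"
  unfolding image_uminus_eq_vimage
  by (rule measurable_sets_borel[of _ borel], intro borel_measurable_continuous_onI continuous_intros)

lemma open_uminus: "open U \<Longrightarrow> open (uminus ` U)" for U :: "'a set"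
  unfolding image_uminus_eq_vimage by (erule open_vimage) (intro continuous_intros)

lemma open_translate: "open U \<Longrightarrow> open ((+) x ` U)" for U :: "'a set"
  unfolding image_plus_eq_vimage by (erule open_vimage) (intro continuous_intros)

lemma measure_translate [simp]: "E \<in> sets borel \<Longrightarrow> measure M ((+) x ` E) = measure M E"
  by (simp add: measure_def emeasure_translate)

lemma measure_Compl: "E \<in> sets borel \<Longrightarrow> measure M (- E) = 1 - measure M E"
  using prob_compl[of E] by (simp add: Compl_eq_Diff_UNIV)

section \<open>Regularity, and small translations in measure\<close>

lemma outer_open:
  assumes "E \<in> sets borel" "e > 0"
  obtains U where "open U" "E \<subseteq> U" "measure M U < measure M E + e"
proof -
  have "emeasure M E < ennreal (measure M E + e)"
    using assms(2) by (simp add: emeasure_eq_measure ennreal_less_iff)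
  then obtain U where U: "open U" "E \<subseteq> U" "emeasure M U < ennreal (measure M E + e)"
    unfolding outer_regular[OF assms(1)] by (auto simp: INF_less_iff)
  then have "measure M U < measure M E + e"
    by (simp add: emeasure_eq_measure ennreal_less_iff)
  with U that show thesis by blast
qed

text \<open>An open set slightly larger than \<open>- E\<close> has a closed, hence compact,
  complement inside \<open>E\<close>.\<close>

lemma inner_compact:
  assumes "E \<in> sets borel" "e > 0"
  obtains K where "compact K" "K \<subseteq> E" "measure M E - e < measure M K"
proof -
  obtain U where U: "open U" "- E \<subseteq> U" "measure M U < measure M (- E) + e"
    using outer_open[OF borel_comp[OF assms(1)] assms(2)] by blast
  show thesis
  proof (rule that[of "- U"])
    show "compact (- U)"
      using compact_Int_closed[OF compact_UNIV, of "- U"] U(1) by auto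
    show "- U \<subseteq> E" using U by auto
    show "measure M E - e < measure M (- U)"
      using U(3) U(1) assms by (simp add: measure_Compl borel_open)
  qed
qed

lemma compact_borel [simp]: "compact K \<Longrightarrow> K \<in> sets borel" for K :: "'a set"
  by (simp add: compact_imp_closed)

text \<open>Tube lemma for the open preimage of \<open>U\<close> under addition, which contains
  \<open>{0} \<times> K\<close>.\<close>

lemma compact_plus_nbhd:
  fixes K U :: "'a set"
  assumes "compact K" "open U" "K \<subseteq> U"
  obtains V where "open V" "0 \<in> V" "\<And>v k. v \<in> V \<Longrightarrow> k \<in> K \<Longrightarrow> v + k \<in> U"
proof -
  let ?W = "(\<lambda>p::'a \<times> 'a. fst p + snd p) -` U"
  have "open ?W"
    using assms(2) by (rule open_vimage; intro continuous_intros)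
  then obtain V where "0 \<in> V" "open V" "V \<times> K \<subseteq> ?W"
    using Elementary_Topology.tube_lemma[OF assms(1), of ?W 0] assms(3) by force
  then show thesis by (intro that[of V]) auto
qed

text \<open>Squeeze \<open>E\<close> between a compact \<open>K\<close> and an open \<open>U\<close>
  of nearly the same measure. For small \<open>v\<close> the set \<open>v + K\<close> stays in
  \<open>U\<close>, so whatever leaves \<open>E\<close> lies in \<open>v + (E - K)\<close> or in
  \<open>U - E\<close>.\<close>

lemma translate_nearly_invariant:
  assumes "E \<in> sets borel" "e > 0"
  obtains V where "open V" "0 \<in> V" "\<And>v. v \<in> V \<Longrightarrow> measure M ((+) v ` E - E) < e"
proof -
  obtain U where U: "open U" "E \<subseteq> U" "measure M U < measure M E + e/2"
    using outer_open[OF assms(1) half_gt_zero[OF assms(2)]] by blast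
  obtain K where K: "compact K" "K \<subseteq> E" "measure M E - e/2 < measure M K"
    using inner_compact[OF assms(1) half_gt_zero[OF assms(2)]] by blast
  obtain V where V: "open V" "0 \<in> V" "\<And>v k. v \<in> V \<Longrightarrow> k \<in> K \<Longrightarrow> v + k \<in> U"
    using compact_plus_nbhd[of K U] K U by blast
  show thesis
  proof (rule that[OF V(1,2)])
    fix v assume v: "v \<in> V"
    have [simp]: "E - K \<in> sets borel" "U - E \<in> sets borel"
      using assms K U by auto
    have "measure M ((+) v ` E - E) \<le> measure M ((+) v ` (E - K) \<union> (U - E))"
      using V(3)[OF v] assms K U
      by (intro finite_measure_mono) auto
    also have "\<dots> \<le> measure M ((+) v ` (E - K)) + measure M (U - E)"
      using assms K U by (intro measure_Un_le) auto
    also have "measure M ((+) v ` (E - K)) = measure M (E - K)"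
      using assms K by simp
    also have "measure M (E - K) = measure M E - measure M K"
      using assms K by (intro finite_measure_Diff) auto
    also have "measure M (U - E) = measure M U - measure M E"
      using assms U by (intro finite_measure_Diff) auto
    finally show "measure M ((+) v ` E - E) < e"
      using U K by linarith
  qed
qed

text \<open>
  \<open>overlap A B\<close> is the convolution of the indicators of \<open>-A\<close> and \<open>B\<close>; in this form it only
  involves translations, so it can be used before reflection invariance of \<open>M\<close> is known.
\<close>

definition overlap :: "'a set \<Rightarrow> 'a set \<Rightarrow> 'a \<Rightarrow> real" where
  "overlap A B x = measure M (B \<inter> (+) x ` A)"

section \<open>Bounds and continuity of the overlap\<close>

lemma overlap_nonneg: "0 \<le> overlap A B x"
  by (simp add: overlap_def)

lemma overlap_le:
  assumes "A \<in> sets borel" "B \<in> sets borel"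
  shows "overlap A B x \<le> measure M A" "overlap A B x \<le> measure M B"
proof -
  have "overlap A B x \<le> measure M ((+) x ` A)"
    unfolding overlap_def using assms by (intro finite_measure_mono) auto
  then show "overlap A B x \<le> measure M A" using assms by simp
  show "overlap A B x \<le> measure M B"
    unfolding overlap_def using assms by (intro finite_measure_mono) auto
qed

lemma overlap_mono:
  assumes "A \<subseteq> A'" "A' \<in> sets borel" "B \<in> sets borel"
  shows "overlap A B x \<le> overlap A' B x"
  unfolding overlap_def using assms by (intro finite_measure_mono) auto

lemma translate_translate: "(+) x ` (+) y ` E = (+) (x + y) ` E" for E :: "'a set"
  by (simp add: image_image add.assoc)

lemma overlap_translate: "overlap ((+) y ` A) B x = overlap A B (x + y)"
  by (simp add: overlap_def translate_translate)

lemma overlap_Compl: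
  assumes "A \<in> sets borel" "B \<in> sets borel"
  shows "overlap (- A) B x = measure M B - overlap A B x"
proof -
  have "B \<inter> (+) x ` (- A) = B - (+) x ` A"
    by (auto simp: image_plus_eq_vimage)
  then show ?thesis
    using assms by (simp add: overlap_def finite_measure_Diff')
qed

lemma overlap_Un_Int:
  assumes "A \<in> sets borel" "A' \<in> sets borel" "B \<in> sets borel"
  shows "overlap (A \<union> A') B x + overlap (A \<inter> A') B x = overlap A B x + overlap A' B x"
proof -
  let ?X = "B \<inter> (+) x ` A" and ?Y = "B \<inter> (+) x ` A'"
  have "B \<inter> (+) x ` (A \<union> A') = ?X \<union> ?Y" "B \<inter> (+) x ` (A \<inter> A') = ?X \<inter> ?Y"
    by (auto simp: image_plus_eq_vimage)
  moreover have "measure M (?X \<union> ?Y) = measure M ?X + measure M ?Y - measure M (?X \<inter> ?Y)"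
    using assms by (intro measure_Un3) (auto simp: fmeasurable_eq_sets)
  ultimately show ?thesis by (simp add: overlap_def)
qed

text \<open>The bound does not depend on \<open>x\<close> or \<open>B\<close>; with the near
  invariance of \<open>A\<close> under small translations it yields continuity of the
  overlap.\<close>

lemma overlap_translate_diff:
  assumes "A \<in> sets borel" "B \<in> sets borel"
  shows "\<bar>overlap A B (v + x) - overlap A B x\<bar> \<le> measure M ((+) v ` A - A)"
proof -
  have sub: "measure M (B \<inter> S) - measure M (B \<inter> T) \<le> measure M (S - T)"
    if "S \<in> sets borel" "T \<in> sets borel" for S T
  proof -
    have "measure M (B \<inter> S) \<le> measure M (B \<inter> T \<union> (S - T))"
      using that assms by (intro finite_measure_mono) auto
    also have "\<dots> \<le> measure M (B \<inter> T) + measure M (S - T)"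
      using that assms by (intro measure_Un_le) auto
    finally show ?thesis by simp
  qed
  let ?S = "(+) x ` ((+) v ` A)" and ?T = "(+) x ` A"
  have 1: "measure M (?S - ?T) = measure M ((+) v ` A - A)"
  proof -
    have "?S - ?T = (+) x ` ((+) v ` A - A)" by (auto simp: image_plus_eq_vimage)
    then show ?thesis using assms by (simp add: sets.Diff)
  qed
  \<comment> \<open>Sets of equal measure have set differences of equal measure, so the one-sided
    difference controls both signs.\<close>
  have 2: "measure M (?T - ?S) = measure M (?S - ?T)"
    using assms finite_measure_Diff'[of ?T ?S] finite_measure_Diff'[of ?S ?T]
    by (simp add: Int_commute)
  have e: "overlap A B (v + x) = measure M (B \<inter> ?S)" "overlap A B x = measure M (B \<inter> ?T)"
    by (simp_all add: overlap_def translate_translate add.commute[of v x])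
  have "overlap A B (v + x) - overlap A B x \<le> measure M (?S - ?T)"
    "overlap A B x - overlap A B (v + x) \<le> measure M (?T - ?S)"
    unfolding e using assms by (auto intro!: sub)
  with 1 2 show ?thesis by linarith
qed

lemma continuous_overlap:
  assumes "A \<in> sets borel" "B \<in> sets borel"
  shows "continuous_on UNIV (overlap A B)"
proof -
  have "(overlap A B \<longlongrightarrow> overlap A B x) (nhds x)" for x
  proof (rule tendstoI)
    fix e :: real assume "e > 0"
    then obtain V where V: "open V" "0 \<in> V" "\<And>v. v \<in> V \<Longrightarrow> measure M ((+) v ` A - A) < e"
      using translate_nearly_invariant assms(1) by blast
    have "eventually (\<lambda>y. y \<in> (+) x ` V) (nhds x)"
      using V open_translate[OF V(1), of x] by (intro eventually_nhds_in_open) (auto simp: image_iff)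
    then show "eventually (\<lambda>y. dist (overlap A B y) (overlap A B x) < e) (nhds x)"
    proof eventually_elim
      case (elim y)
      then obtain v where "v \<in> V" "y = v + x" by (auto simp: add.commute)
      then show ?case
        using overlap_translate_diff[OF assms, of v x] V(3)[of v] by (simp add: dist_real_def)
    qed
  qed
  then show ?thesis
    unfolding continuous_on_def at_within_def by (meson inf_le1 tendsto_mono)
qed

lemma overlap_measurable:
  assumes "A \<in> sets borel" "B \<in> sets borel"
  shows "overlap A B \<in> borel_measurable borel"
  by (intro borel_measurable_continuous_onI continuous_overlap assms)

lemma integrable_bounded_overlap:
  assumes "A \<in> sets borel" "B \<in> sets borel" "f \<in> borel_measurable borel"
    "\<And>y. 0 \<le> y \<Longrightarrow> y \<le> 1 \<Longrightarrow> \<bar>f y\<bar> \<le> (c::real)"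
  shows "integrable M (\<lambda>x. f (overlap A B x))"
proof (rule integrable_const_bound[where B=c])
  show "AE x in M. norm (f (overlap A B x)) \<le> c"
  proof (rule AE_I2)
    fix x
    show "norm (f (overlap A B x)) \<le> c"
      using assms(4)[OF overlap_nonneg order_trans[OF overlap_le(1)[OF assms(1,2)] prob_le_1]]
      by simp
  qed
  show "(\<lambda>x. f (overlap A B x)) \<in> borel_measurable M"
    unfolding measurable_cong_sets[OF sets_M refl]
    by (rule measurable_compose[OF overlap_measurable[OF assms(1,2)] assms(3)])
qed

lemma integrable_overlap:
  assumes "A \<in> sets borel" "B \<in> sets borel"
  shows "integrable M (overlap A B)"
  by (rule integrable_bounded_overlap[OF assms, of "\<lambda>x. x" 1]) auto

lemma integrable_indicator_borel:
  "F \<in> sets borel \<Longrightarrow> integrable M (indicator F :: 'a \<Rightarrow> real)"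
  by (rule integrable_real_indicator) (simp_all add: emeasure_eq_measure)

text \<open>
  Fubini's theorem does not apply, since Borel sets of \<open>G \<times> G\<close> need not be in the product
  sigma-algebra when \<open>G\<close> is not second countable. It is replaced by a finite Borel partition of \<open>G\<close>
  into pieces so small that \<open>x + K\<close> barely moves as \<open>x\<close> runs through a piece.
\<close>

lemma integral_overlap_compact_le:
  assumes K: "compact K" and B: "B \<in> sets borel"
  shows "(LINT x|M. overlap K B x) \<le> measure M (uminus ` K) * measure M B"
proof -
  have "(LINT x|M. overlap K B x) \<le> measure M (uminus ` K) * measure M B + e"
    if e: "e > 0" for e
  proof -
    \<comment> \<open>\<open>U'\<close> will contain, up to translation, all pieces that matter for
      one \<open>y\<close>; its excess over \<open>-K\<close> becomes the final error
      \<open>e\<close>.\<close>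
    obtain U' where U': "open U'" "uminus ` K \<subseteq> U'" "measure M U' < measure M (uminus ` K) + e"
      using outer_open[of "uminus ` K" e] borel_uminus[OF compact_borel[OF K]] e by blast
    have "open (uminus ` U')" by (rule open_uminus[OF U'(1)])
    moreover have "K \<subseteq> uminus ` U'" using U'(2) by (force simp: image_iff)
    ultimately obtain W where W: "open W" "0 \<in> W"
      "\<And>w k. w \<in> W \<Longrightarrow> k \<in> K \<Longrightarrow> w + k \<in> uminus ` U'"
      using compact_plus_nbhd[OF K] by blast
    have "open ((\<lambda>p::'a \<times> 'a. fst p - snd p) -` W)"
      using W(1) by (rule open_vimage) (intro continuous_intros)
    moreover have "(0, 0) \<in> (\<lambda>p::'a \<times> 'a. fst p - snd p) -` W" using W(2) by simp
    ultimately obtain V1 V2 where V12: "open V1" "open V2" "0 \<in> V1" "0 \<in> V2"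
      "V1 \<times> V2 \<subseteq> (\<lambda>p::'a \<times> 'a. fst p - snd p) -` W"
      by (elim open_prod_elim) auto
    \<comment> \<open>Differences of elements of \<open>V\<close> lie in \<open>W\<close>, which
      absorbs the choice of two points in the same translate of \<open>V\<close>.\<close>
    define V where "V = V1 \<inter> V2"
    have V: "open V" "0 \<in> V" "\<And>v w. v \<in> V \<Longrightarrow> w \<in> V \<Longrightarrow> v - w \<in> W"
      using V12 by (auto simp: V_def)
    \<comment> \<open>Thickening \<open>K\<close> by \<open>V\<close> gives
      \<open>x + K \<subseteq> f i + S\<close> for all \<open>x\<close> in \<open>f i + V\<close>,
      so the constant \<open>c i\<close> below bounds the overlap on a whole piece.\<close>
    define S where "S = (\<Union>k\<in>K. (+) k ` V)"
    have S: "open S" unfolding S_def using open_translate[OF V(1)] by auto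
    obtain X where X: "finite X" "UNIV \<subseteq> (\<Union>x\<in>X. (+) x ` V)"
    proof (rule compactE_image[OF compact_UNIV, of UNIV "\<lambda>x. (+) x ` V"])
      show "UNIV \<subseteq> (\<Union>x\<in>UNIV. (+) x ` V)" using V(2) by force
    qed (use open_translate[OF V(1)] in auto)
    obtain n :: nat and f where f: "X = f ` {i. i < n}"
      using finite_imp_nat_seg_image_inj_on[OF X(1)] by blast
    define E where "E = disjointed (\<lambda>i. (+) (f i) ` V)"
    have E_sets [simp]: "E i \<in> sets borel" for i
    proof -
      have "range (\<lambda>i. (+) (f i) ` V) \<subseteq> sets borel"
        using open_translate[OF V(1)] by auto
      then show ?thesis unfolding E_def using sets.range_disjointed_sets by blast
    qed
    have E_sub: "E i \<subseteq> (+) (f i) ` V" for i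
      unfolding E_def by (rule disjointed_subset)
    have E_disj: "disjoint_family E"
      unfolding E_def by (rule disjoint_family_disjointed)
    have E_cover: "\<exists>i<n. x \<in> E i" for x
    proof -
      have "(\<Union>i\<in>{0..<n}. E i) = (\<Union>i\<in>{0..<n}. (+) (f i) ` V)"
        unfolding E_def by (rule finite_UN_disjointed_eq)
      moreover obtain z where "z \<in> X" "x \<in> (+) z ` V" using X(2) by blast
      ultimately have "x \<in> (\<Union>i\<in>{0..<n}. E i)" using f by fastforce
      then show ?thesis unfolding atLeast0LessThan by blast
    qed
    have BS [simp]: "B \<inter> (+) x ` S \<in> sets borel" for x
      using B open_translate[OF S] by auto
    define c where "c i = measure M (B \<inter> (+) (f i) ` S)" for i
    have S_borel [simp]: "(+) x ` S \<in> sets borel" for x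
      using open_translate[OF S] by auto
    have "(LINT x|M. overlap K B x) \<le> (LINT x|M. (\<Sum>i<n. indicator (E i) x * c i))"
    proof (rule integral_mono)
      show "integrable M (overlap K B)" using K B by (intro integrable_overlap) auto
      show "integrable M (\<lambda>x. \<Sum>i<n. indicator (E i) x * c i)"
        by (intro Bochner_Integration.integrable_sum integrable_mult_left
            integrable_indicator_borel) simp
      fix x
      obtain i where i: "i < n" "x \<in> E i" using E_cover by blast
      obtain v where v: "v \<in> V" "x = f i + v" using E_sub i by blast
      have "(+) x ` K \<subseteq> (+) (f i) ` S"
      proof
        fix y assume "y \<in> (+) x ` K"
        then obtain k where "k \<in> K" "y = f i + (k + v)"
          using v by (auto simp: algebra_simps)
        then show "y \<in> (+) (f i) ` S" unfolding S_def using v by blast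
      qed
      then have "overlap K B x \<le> c i"
        unfolding overlap_def c_def using K B by (intro finite_measure_mono) auto
      also have "\<dots> = (\<Sum>j\<in>{i}. indicator (E j) x * c j)" using i by simp
      also have "\<dots> \<le> (\<Sum>j<n. indicator (E j) x * c j)"
        using i by (intro sum_mono2) (auto simp: c_def)
      finally show "overlap K B x \<le> (\<Sum>i<n. indicator (E i) x * c i)" .
    qed
    also have "\<dots> = (\<Sum>i<n. measure M (E i) * c i)"
      by (subst Bochner_Integration.integral_sum)
        (simp_all add: integrable_indicator_borel)
    \<comment> \<open>The order of integration is exchanged here; for a finite sum this is
      linearity.\<close>
    also have "\<dots> = (\<Sum>i<n. (LINT y|M. measure M (E i) * indicator (B \<inter> (+) (f i) ` S) y))"
      by (simp add: c_def)
    also have "\<dots> = (LINT y|M. (\<Sum>i<n. measure M (E i) * indicator (B \<inter> (+) (f i) ` S) y))"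
      by (subst Bochner_Integration.integral_sum) (simp_all add: integrable_indicator_borel)
    also have "\<dots> \<le> (LINT y|M. measure M U' * indicator B y)"
    proof (rule integral_mono)
      show "integrable M (\<lambda>y. \<Sum>i<n. measure M (E i) * indicator (B \<inter> (+) (f i) ` S) y)"
        by (intro Bochner_Integration.integrable_sum integrable_mult_right
            integrable_indicator_borel) simp
      show "integrable M (\<lambda>y. measure M U' * indicator B y)"
        using B by (intro integrable_mult_right integrable_indicator_borel)
      fix y
      \<comment> \<open>If \<open>x = f i + w\<close> lies in a piece indexed by \<open>?J\<close>
        and \<open>y = f i + (k + v)\<close>, then \<open>y - x = (v - w) + k\<close> lies in
        \<open>-U'\<close>. So all these disjoint pieces sit inside \<open>y + U'\<close>.\<close>
      let ?J = "{i. i < n \<and> y \<in> (+) (f i) ` S}"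
      have "(\<Sum>i<n. measure M (E i) * indicator (B \<inter> (+) (f i) ` S) y)
          = (\<Sum>i<n. if i \<in> ?J then measure M (E i) * indicator B y else 0)"
        by (intro sum.cong) (auto simp: indicator_def)
      also have "\<dots> = (\<Sum>i\<in>?J. measure M (E i) * indicator B y)"
        by (subst sum.inter_restrict[symmetric]) (auto intro!: sum.cong)
      also have "\<dots> = (\<Sum>i\<in>?J. measure M (E i)) * indicator B y"
        by (simp add: sum_distrib_right)
      also have "(\<Sum>i\<in>?J. measure M (E i)) = measure M (\<Union>i\<in>?J. E i)"
        using E_disj by (intro finite_measure_finite_Union[symmetric])
          (auto simp: disjoint_family_on_def)
      also have "\<dots> \<le> measure M ((+) y ` U')"
      proof (rule finite_measure_mono)
        show "(\<Union>i\<in>?J. E i) \<subseteq> (+) y ` U'"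
        proof
          fix x assume "x \<in> (\<Union>i\<in>?J. E i)"
          then obtain i where i: "x \<in> E i" "y \<in> (+) (f i) ` S" by blast
          obtain w where w: "w \<in> V" "x = f i + w" using E_sub i by blast
          obtain v k where v: "v \<in> V" "k \<in> K" "y = f i + (k + v)"
            using i unfolding S_def by blast
          have "v - w + k \<in> uminus ` U'" using V(3) W(3) v w by blast
          then have "x - y \<in> U'"
            using v w by (auto simp: image_uminus_eq_vimage algebra_simps)
          then show "x \<in> (+) y ` U'" by (simp add: image_plus_eq_vimage)
        qed
        show "(+) y ` U' \<in> sets M" using open_translate[OF U'(1)] by auto
      qed
      also have "\<dots> = measure M U'" using U'(1) by simp
      finally show "(\<Sum>i<n. measure M (E i) * indicator (B \<inter> (+) (f i) ` S) y)
        \<le> measure M U' * indicator B y"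
        by (auto simp: indicator_def)
    qed
    also have "\<dots> = measure M U' * measure M B" using B by simp
    also have "\<dots> \<le> (measure M (uminus ` K) + e) * measure M B"
      using U'(3) by (intro mult_right_mono) auto
    also have "\<dots> \<le> measure M (uminus ` K) * measure M B + e"
      using e prob_le_1[of B] by (simp add: distrib_right mult_left_le)
    finally show ?thesis .
  qed
  then show ?thesis by (rule field_le_epsilon)
qed

section \<open>Reflection invariance and the mean of the overlap\<close>

lemma measure_UNIV [simp]: "measure M UNIV = 1"
  using prob_space by simp

text \<open>For \<open>B = UNIV\<close> the overlap is constant, so the preceding inequality says
  that a compact \<open>K\<close> has at most the measure of \<open>-K\<close>. Inner regularity
  extends this to Borel sets, and applying it to \<open>-E\<close> reverses it.\<close>

lemma measure_uminus [simp]: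
  assumes "E \<in> sets borel"
  shows "measure M (uminus ` E) = measure M E"
proof -
  have compact_le: "measure M K \<le> measure M (uminus ` K)" if "compact K" for K
    using integral_overlap_compact_le[OF that, of UNIV] prob_space that
    by (simp add: overlap_def)
  have le: "measure M F \<le> measure M (uminus ` F)" if F: "F \<in> sets borel" for F
  proof (rule field_le_epsilon)
    fix e :: real assume "e > 0"
    then obtain K where K: "compact K" "K \<subseteq> F" "measure M F - e < measure M K"
      using inner_compact[OF F] by blast
    have "measure M (uminus ` K) \<le> measure M (uminus ` F)"
      using K F by (intro finite_measure_mono) auto
    then show "measure M F \<le> measure M (uminus ` F) + e"
      using compact_le[OF K(1)] K by linarith
  qed
  show ?thesis
    using le[OF assms] le[OF borel_uminus[OF assms]] by (simp add: image_image)
qed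

text \<open>Inner approximation carries the upper bound from compact to Borel sets. Applied to
  \<open>- A\<close> it becomes the lower bound, since the overlaps of \<open>A\<close> and
  \<open>- A\<close> add up to \<open>measure M B\<close>.\<close>

lemma integral_overlap:
  assumes A: "A \<in> sets borel" and B: "B \<in> sets borel"
  shows "(LINT x|M. overlap A B x) = measure M A * measure M B"
proof -
  have le: "(LINT x|M. overlap A B x) \<le> measure M A * measure M B" if A: "A \<in> sets borel" for A
  proof (rule field_le_epsilon)
    fix e :: real assume "e > 0"
    then obtain K where K: "compact K" "K \<subseteq> A" "measure M A - e < measure M K"
      using inner_compact[OF A] by blast
    have Kb: "K \<in> sets borel" "A - K \<in> sets borel" using K A by auto
    have "overlap A B x \<le> overlap K B x + e" for x
    proof -
      have "overlap A B x = overlap K B x + overlap (A - K) B x"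
        using overlap_Un_Int[OF Kb B, of x] K(2) by (simp add: Un_absorb1 overlap_def)
      also have "overlap (A - K) B x \<le> measure M (A - K)"
        by (intro overlap_le Kb B)
      also have "measure M (A - K) = measure M A - measure M K"
        using K A by (intro finite_measure_Diff) auto
      finally show ?thesis using K by linarith
    qed
    then have "(LINT x|M. overlap A B x) \<le> (LINT x|M. overlap K B x + e)"
      using integrable_overlap[OF A B] integrable_overlap[OF Kb(1) B]
      by (intro integral_mono) auto
    also have "\<dots> = (LINT x|M. overlap K B x) + e"
      using integrable_overlap[OF Kb(1) B] by simp
    also have "(LINT x|M. overlap K B x) \<le> measure M K * measure M B"
      using integral_overlap_compact_le[OF K(1) B] Kb by simp
    also have "\<dots> \<le> measure M A * measure M B"
      using K A by (intro mult_right_mono finite_measure_mono) auto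
    finally show "(LINT x|M. overlap A B x) \<le> measure M A * measure M B + e" by simp
  qed
  have "(LINT x|M. overlap (- A) B x) = (LINT x|M. measure M B - overlap A B x)"
    by (simp add: overlap_Compl[OF A B])
  also have "\<dots> = measure M B - (LINT x|M. overlap A B x)"
    using integrable_overlap[OF A B] by simp
  finally have "measure M B - (LINT x|M. overlap A B x) \<le> (1 - measure M A) * measure M B"
    using le[of "- A"] A by (simp add: measure_Compl)
  with le[OF A] show ?thesis by (simp add: algebra_simps)
qed

lemma integral_translate:
  fixes f :: "'a \<Rightarrow> real"
  assumes f: "f \<in> borel_measurable borel"
  shows "(LINT x|M. f (x + y)) = (LINT x|M. f x)"
proof -
  have m: "(\<lambda>x. x + y) \<in> measurable M M"
    unfolding measurable_cong_sets[OF sets_M sets_M]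
    by (intro borel_measurable_continuous_onI continuous_intros)
  have "distr M M (\<lambda>x. x + y) = M"
  proof (rule measure_eqI)
    fix E assume "E \<in> sets (distr M M (\<lambda>x. x + y))"
    then have E: "E \<in> sets borel" by simp
    have "(\<lambda>x. x + y) -` E = (+) (- y) ` E"
      unfolding image_plus_eq_vimage by simp
    then show "emeasure (distr M M (\<lambda>x. x + y)) E = emeasure M E"
      using m E emeasure_translate[OF E, of "- y"] by (simp add: emeasure_distr)
  qed simp
  moreover have "(LINT x|distr M M (\<lambda>x. x + y). f x) = (LINT x|M. f (x + y))"
    using m f by (intro integral_distr) (auto simp: measurable_cong_sets[OF sets_M refl])
  ultimately show ?thesis by simp
qed

section \<open>Submodularity and the truncated convolution\<close>

definition capped :: "'a set \<Rightarrow> 'a set \<Rightarrow> real \<Rightarrow> real" where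
  "capped A B t = (LINT x|M. min (overlap A B x) t)"

lemma integrable_capped:
  assumes "A \<in> sets borel" "B \<in> sets borel"
  shows "integrable M (\<lambda>x. min (overlap A B x) t)"
  by (rule integrable_bounded_overlap[OF assms, of "\<lambda>y. min y t" "max 1 \<bar>t\<bar>"]) auto

lemma capped_nonneg: "0 \<le> t \<Longrightarrow> 0 \<le> capped A B t"
  unfolding capped_def by (intro Bochner_Integration.integral_nonneg) (auto simp: overlap_nonneg)

lemma capped_translate:
  assumes "A \<in> sets borel" "B \<in> sets borel"
  shows "capped ((+) y ` A) B t = capped A B t"
  unfolding capped_def overlap_translate
  using integral_translate[of "\<lambda>x. min (overlap A B x) t" y] overlap_measurable[OF assms]
  by simp

text \<open>Pointwise, the overlaps of union and intersection have the same sum as those of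
  \<open>A\<close> and \<open>A'\<close> but lie further apart, and a concave function has the
  smaller sum on the wider pair.\<close>

lemma capped_Un_Int_le:
  assumes "A \<in> sets borel" "A' \<in> sets borel" "B \<in> sets borel"
  shows "capped (A \<union> A') B t + capped (A \<inter> A') B t \<le> capped A B t + capped A' B t"
proof -
  let ?f = "\<lambda>A x. min (overlap A B x) t"
  have "?f (A \<union> A') x + ?f (A \<inter> A') x \<le> ?f A x + ?f A' x" for x
    using overlap_Un_Int[OF assms, of x] assms
      overlap_mono[of A "A \<union> A'" B x] overlap_mono[of A' "A \<union> A'" B x]
    by (auto simp: min_def)
  then have "(LINT x|M. ?f (A \<union> A') x + ?f (A \<inter> A') x) \<le> (LINT x|M. ?f A x + ?f A' x)"
    using assms by (intro integral_mono Bochner_Integration.integrable_add integrable_capped) auto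
  then show ?thesis
    unfolding capped_def using assms
    by (simp add: integrable_capped)
qed

text \<open>The mean \<open>(measure M A)\<^sup>2\<close> forces a value at most that large, the
  value at 0 is \<open>measure M A\<close>, and the image of a connected space under a continuous
  function is an interval.\<close>

lemma overlap_self_attains:
  assumes conn: "connected (UNIV :: 'a set)" and A: "A \<in> sets borel"
    and v: "(measure M A)\<^sup>2 \<le> v" "v \<le> measure M A"
  obtains x where "overlap A A x = v"
proof -
  have "\<exists>x. overlap A A x \<le> (measure M A)\<^sup>2"
  proof (rule ccontr)
    assume "\<not> ?thesis"
    then have "(LINT x|M. (measure M A)\<^sup>2) < (LINT x|M. overlap A A x)"
      using integrable_overlap[OF A A]
      by (intro integral_less_AE_space) (auto simp: not_le emeasure_space_1[simplified])
    then show False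
      by (simp add: integral_overlap[OF A A] power2_eq_square)
  qed
  then obtain y where y: "overlap A A y \<le> v" using v(1) order_trans by blast
  have 0: "overlap A A 0 = measure M A" by (simp add: overlap_def)
  have "connected (range (overlap A A))"
    by (intro connected_continuous_image continuous_overlap conn A)
  from connectedD_interval[OF this rangeI rangeI y] have "v \<in> range (overlap A A)"
    using v 0 by metis
  then show thesis using that by blast
qed

text \<open>Rewritten, the claim is \<open>\<delta> \<le> F A\<close>, with \<open>\<delta>\<close>
  the value of \<open>F\<close> at both ends of the range of measures. The infimum \<open>m\<close>
  may fail to be attained, so concavity is used quantitatively: \<open>m < \<delta>\<close> would
  keep every \<open>F E\<close> above \<open>m\<close> by a fixed amount.\<close>

lemma capped_ge:
  assumes conn: "connected (UNIV :: 'a set)"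
    and A: "A \<in> sets borel" and B: "B \<in> sets borel"
    and t: "0 < t" "t < measure M B" "t \<le> measure M A" "measure M A \<le> 1 - measure M B + t"
  shows "t * (measure M A + measure M B - t) \<le> capped A B t"
proof -
  define b where "b = measure M B"
  define F where "F E = capped E B t - t * measure M E" for E
  define \<S> where "\<S> = {E \<in> sets borel. t \<le> measure M E \<and> measure M E \<le> 1 - b + t}"
  define m where "m = (INF E\<in>\<S>. F E)"
  \<comment> \<open>Besides being the end value of \<open>F\<close>, this is a safe step size: on
    \<open>\<S>\<close> the measure is at least \<open>t\<close> and its complement at least
    \<open>b - t\<close>, so their product is at least \<open>\<delta>\<close>.\<close>
  define \<delta> where "\<delta> = t * (b - t)"
  have b: "t < b" "b \<le> 1" using t unfolding b_def by auto
  have \<delta>: "0 < \<delta>" using t b by (simp add: \<delta>_def)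
  have bdd: "bdd_below (F ` \<S>)"
  proof (rule bdd_belowI2[where m="- t"])
    fix E assume "E \<in> \<S>"
    have "t * measure M E \<le> t" using t by (simp add: mult_left_le)
    moreover have "0 \<le> capped E B t" using t by (intro capped_nonneg) simp
    ultimately show "- t \<le> F E" unfolding F_def by linarith
  qed
  have m_le: "m \<le> F E" if "E \<in> \<S>" for E
    unfolding m_def by (rule cINF_lower[OF bdd that])
  \<comment> \<open>Here the overlap never exceeds the cap, so truncation changes nothing and the
    mean \<open>t * b\<close> remains.\<close>
  have lower_end: "F E = \<delta>" if E: "E \<in> sets borel" "measure M E = t" for E
  proof -
    have "min (overlap E B x) t = overlap E B x" for x
      using overlap_le(1)[OF E(1) B, of x] E by simp
    then have "capped E B t = t * b"
      using E by (simp add: capped_def integral_overlap[OF E(1) B] b_def)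
    then show ?thesis using E by (simp add: F_def \<delta>_def algebra_simps)
  qed
  \<comment> \<open>Here the complement of \<open>E\<close> overlaps \<open>B\<close> in at most
    \<open>b - t\<close>, so the overlap of \<open>E\<close> is everywhere at least \<open>t\<close>
    and the cap always applies.\<close>
  have upper_end: "F E = \<delta>" if E: "E \<in> sets borel" "measure M E = 1 - b + t" for E
  proof -
    have "min (overlap E B x) t = t" for x
    proof -
      have "overlap (- E) B x \<le> measure M (- E)"
        using E B by (intro overlap_le) auto
      then have "t \<le> overlap E B x"
        using E B by (simp add: overlap_Compl measure_Compl b_def)
      then show ?thesis by simp
    qed
    then have "capped E B t = t" by (simp add: capped_def)
    then show ?thesis unfolding F_def \<delta>_def E(2) by (simp add: algebra_simps)
  qed
  \<comment> \<open>The two sets are the intersection and union of \<open>E\<close> with a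
    translate, chosen so that exactly \<open>s\<close> is lost by the one and gained by the other;
    submodularity bounds the sum.\<close>
  have split: "\<exists>E1 E2. E1 \<in> sets borel \<and> E2 \<in> sets borel \<and> measure M E1 = measure M E - s \<and>
      measure M E2 = measure M E + s \<and> F E1 + F E2 \<le> 2 * F E"
    if E: "E \<in> \<S>" and s: "0 \<le> s" "s \<le> \<delta>" for E s
  proof -
    have Eb: "E \<in> sets borel" and Em: "t \<le> measure M E" "measure M E \<le> 1 - b + t"
      using E by (auto simp: \<S>_def)
    have "t * (b - t) \<le> measure M E * (1 - measure M E)"
      using Em t b by (intro mult_mono) auto
    then have "(measure M E)\<^sup>2 \<le> measure M E - s"
      using s unfolding \<delta>_def by (simp add: power2_eq_square algebra_simps)
    then obtain x where x: "overlap E E x = measure M E - s"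
      using overlap_self_attains[OF conn Eb, of "measure M E - s"] s by auto
    let ?E' = "(+) x ` E"
    have "measure M (E \<union> ?E') = measure M E + measure M ?E' - measure M (E \<inter> ?E')"
      using Eb by (intro measure_Un3) (auto simp: fmeasurable_eq_sets)
    then have eqs: "measure M (E \<union> ?E') = measure M E + s" "measure M (E \<inter> ?E') = measure M E - s"
      using x Eb by (simp_all add: overlap_def)
    moreover have "F (E \<inter> ?E') + F (E \<union> ?E') \<le> 2 * F E"
      using capped_Un_Int_le[OF Eb borel_translate[OF Eb] B, of x t] capped_translate[OF Eb B, of x t]
      unfolding F_def eqs by (simp add: algebra_simps)
    moreover have "E \<inter> ?E' \<in> sets borel" "E \<union> ?E' \<in> sets borel" using Eb by auto
    ultimately show ?thesis by blast
  qed
  have "\<delta> \<le> m"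
  proof (rule ccontr)
    assume "\<not> \<delta> \<le> m"
    then have gap: "0 < \<delta> - m" by simp
    \<comment> \<open>A splitting moves the measure by \<open>\<delta>\<close>, or less if that reaches an end of the range. As both
      parts have excess \<open>\<ge> 0\<close> over \<open>m\<close>, each has at most twice the excess of the set that was split.\<close>
    have walk: "(1/2)^n * (\<delta> - m) \<le> F E - m"
      if "E \<in> \<S>" "measure M E - t \<le> real n * \<delta>" for n E
      using that
    proof (induction n arbitrary: E)
      case 0
      then have "measure M E = t" "E \<in> sets borel" by (auto simp: \<S>_def)
      then show ?case by (simp add: lower_end)
    next
      case (Suc n)
      have pow: "(1/2)^n * (\<delta> - m) \<le> \<delta> - m"
        using gap by (intro mult_left_le_one_le) (auto simp: power_le_one)
      have E: "t \<le> measure M E" "measure M E \<le> 1 - b + t" using Suc.prems by (auto simp: \<S>_def)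
      define s where "s = min \<delta> (min (measure M E - t) (1 - b + t - measure M E))"
      have "0 \<le> s" "s \<le> \<delta>" using E \<delta> by (auto simp: s_def)
      then obtain E1 E2 where E12: "E1 \<in> sets borel" "E2 \<in> sets borel"
        "measure M E1 = measure M E - s" "measure M E2 = measure M E + s" "F E1 + F E2 \<le> 2 * F E"
        using split[OF Suc.prems(1), of s] by blast
      have in_S: "E1 \<in> \<S>" "E2 \<in> \<S>"
        using E12 E \<delta> by (auto simp: \<S>_def s_def)
      \<comment> \<open>In the first case \<open>E2\<close> is at the upper end and has excess
        \<open>\<delta> - m\<close> by itself. Otherwise \<open>E1\<close> is nearer to
        \<open>t\<close> by \<open>\<delta>\<close>, or at \<open>t\<close>, and the induction
        hypothesis applies to it.\<close>
      have "(1/2)^n * (\<delta> - m) \<le> (F E1 - m) + (F E2 - m)"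
      proof (cases "s = 1 - b + t - measure M E")
        case True
        then have "F E2 = \<delta>" using E12 by (intro upper_end) auto
        then show ?thesis using pow m_le[OF in_S(1)] by linarith
      next
        case False
        then have "s = \<delta> \<or> s = measure M E - t"
          unfolding s_def by linarith
        moreover have "0 \<le> real n * \<delta>" "real (Suc n) * \<delta> = real n * \<delta> + \<delta>"
          using \<delta> by (simp_all add: algebra_simps)
        ultimately have "measure M E1 - t \<le> real n * \<delta>"
          using E12(3) Suc.prems(2) by linarith
        from Suc.IH[OF in_S(1) this] show ?thesis using m_le[OF in_S(2)] by linarith
      qed
      then show ?case using E12(5) by simp
    qed
    \<comment> \<open>Measures are at most 1, so this \<open>n\<close> serves all members of
      \<open>\<S>\<close> at once, and the resulting uniform excess contradicts \<open>m\<close>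
      being the infimum.\<close>
    obtain n :: nat where n: "1 / \<delta> \<le> real n" using real_arch_simple by blast
    have "m + (1/2)^n * (\<delta> - m) \<le> F E" if "E \<in> \<S>" for E
    proof -
      have "1 \<le> real n * \<delta>" using n \<delta> by (simp add: field_simps)
      moreover have "measure M E - t \<le> 1" using prob_le_1[of E] t by linarith
      ultimately show ?thesis using walk[OF that, of n] by linarith
    qed
    moreover have "\<S> \<noteq> {}" using A t by (auto simp: \<S>_def b_def)
    ultimately have "m + (1/2)^n * (\<delta> - m) \<le> m"
      unfolding m_def by (intro cINF_greatest)
    then have "(1/2)^n * (\<delta> - m) \<le> 0" by simp
    moreover have "0 < (1/2)^n * (\<delta> - m)" using gap by simp
    ultimately show False by linarith
  qed
  moreover have "A \<in> \<S>" using A t by (auto simp: \<S>_def b_def)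
  ultimately have "\<delta> \<le> F A" using m_le by force
  then show ?thesis by (simp add: F_def \<delta>_def b_def algebra_simps)
qed

text \<open>These are to be matched by the lower bounds for arcs. The fourth subtracts from the
  total integral a lower bound for the part outside \<open>C\<close>; the fifth comes from
  truncation.\<close>

lemma integral_indicator_overlap_bounds:
  assumes A: "A \<in> sets borel" and B: "B \<in> sets borel" and C: "C \<in> sets borel"
  defines "I \<equiv> LINT x|M. indicator C x * overlap A B x"
    and "a \<equiv> measure M A" and "b \<equiv> measure M B" and "c \<equiv> measure M C"
  shows "I \<le> a * c" and "I \<le> b * c" and "I \<le> a * b"
    and "I \<le> a * b - (1 - c) * (a + b - 1)"
    and "connected (UNIV :: 'a set) \<Longrightarrow> 0 < t \<Longrightarrow> t < a \<Longrightarrow> t < b \<Longrightarrow> a + b - t \<le> 1 \<Longrightarrow>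
      I \<le> t * c + a * b - t * (a + b - t)"
proof -
  have int: "integrable M (\<lambda>x. indicator C x * overlap A B x)"
    using integrable_overlap[OF A B] C
    by (subst mult.commute) (intro integrable_real_mult_indicator, auto)
  have intC: "integrable M (\<lambda>x. indicator C x * k)" for k :: real
    using integrable_indicator_borel[OF C] by (rule integrable_mult_left)
  have intK: "(LINT x|M. indicator C x * k) = c * k" for k :: real
    using C by (simp add: c_def)
  have le: "overlap A B x \<le> a" "overlap A B x \<le> b" for x
    unfolding a_def b_def by (intro overlap_le A B)+
  have "I \<le> (LINT x|M. indicator C x * a)" "I \<le> (LINT x|M. indicator C x * b)"
    unfolding I_def using le by (intro integral_mono int intC mult_left_mono; simp)+
  then show "I \<le> a * c" "I \<le> b * c"
    unfolding intK by (simp_all add: mult.commute)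
  have "I \<le> (LINT x|M. overlap A B x)"
    unfolding I_def
    by (intro integral_mono int integrable_overlap A B)
      (auto simp: indicator_def overlap_nonneg)
  then show "I \<le> a * b" by (simp add: integral_overlap[OF A B] a_def b_def)
  \<comment> \<open>A translate of \<open>- A\<close> covers at most \<open>1 - a\<close> of
    \<open>B\<close>.\<close>
  have "a + b - 1 \<le> overlap A B x" for x
    using overlap_le(1)[of "- A" B x] A B
    by (simp add: overlap_Compl measure_Compl a_def b_def)
  then have pt: "indicator C x * overlap A B x
      \<le> overlap A B x - (1 - indicator C x) * (a + b - 1)" for x
    by (auto simp: indicator_def)
  have i1: "integrable M (\<lambda>x. (1 - indicator C x) * (a + b - 1))"
    by (intro integrable_mult_left Bochner_Integration.integrable_diff integrable_indicator_borel C)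
      simp
  have "I \<le> (LINT x|M. overlap A B x - (1 - indicator C x) * (a + b - 1))"
    unfolding I_def
    by (intro integral_mono int Bochner_Integration.integrable_diff integrable_overlap A B i1 pt)
  also have "\<dots> = (LINT x|M. overlap A B x) - (LINT x|M. (1 - indicator C x) * (a + b - 1))"
    by (intro Bochner_Integration.integral_diff integrable_overlap A B i1)
  also have "(LINT x|M. (1 - indicator C x) * (a + b - 1)) = (1 - c) * (a + b - 1)"
    using integrable_indicator_borel[OF C] C by (simp add: c_def)
  finally show "I \<le> a * b - (1 - c) * (a + b - 1)"
    by (simp add: integral_overlap[OF A B] a_def b_def)
  assume conn: "connected (UNIV :: 'a set)" and t: "0 < t" "t < a" "t < b" "a + b - t \<le> 1"
  have cap: "t * (a + b - t) \<le> capped A B t"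
    unfolding a_def b_def using t by (intro capped_ge conn A B) (auto simp: a_def b_def)
  \<comment> \<open>On \<open>C\<close> the overlap is its truncation, at most \<open>t\<close>,
    plus the excess over \<open>t\<close>; off \<open>C\<close> the excess is still
    nonnegative.\<close>
  have "indicator C x * overlap A B x
      \<le> indicator C x * t + (overlap A B x - min (overlap A B x) t)" for x
    using t by (auto simp: indicator_def)
  then have "I \<le> (LINT x|M. indicator C x * t + (overlap A B x - min (overlap A B x) t))"
    unfolding I_def
    by (intro integral_mono int Bochner_Integration.integrable_add intC
        Bochner_Integration.integrable_diff integrable_overlap integrable_capped A B)
  also have "\<dots> = (LINT x|M. indicator C x * t) + ((LINT x|M. overlap A B x) - capped A B t)"
    unfolding capped_def
    by (subst Bochner_Integration.integral_add)
      (intro intC Bochner_Integration.integrable_diff Bochner_Integration.integral_diff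
        integrable_overlap integrable_capped A B arg_cong2[where f="(+)"] refl)+
  also have "\<dots> = c * t + (a * b - capped A B t)"
    by (simp only: intK integral_overlap[OF A B] a_def b_def)
  finally show "I \<le> t * c + a * b - t * (a + b - t)" using cap by (simp add: mult.commute)
qed

end

section \<open>Arcs on the circle\<close>

lemma to_circle_diff: "to_circle x - to_circle y = to_circle (x - y)"
  by (rule minus_circle.abs_eq)

lemma to_circle_add_1: "to_circle (1 + x) = to_circle x"
  by (simp add: to_circle_eq_iff)

lemma measurable_circle:
  fixes f :: "circle \<Rightarrow> 'b::topological_space"
  assumes "(\<lambda>x. f (to_circle x)) \<in> borel_measurable borel"
  shows "f \<in> borel_measurable circle_measure"
proof (rule measurableI)
  fix S :: "'b set" assume "S \<in> sets borel"
  then have "(\<lambda>x. f (to_circle x)) -` S \<in> sets borel"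
    using measurable_sets_borel[OF assms] by simp
  then show "f -` S \<inter> space circle_measure \<in> sets circle_measure"
    by (simp add: sets_circle_measure vimage_def)
qed simp

text \<open>A fundamental domain symmetric about 0 suits centered arcs: the half
  \<open>{1/2..<1}\<close> is shifted by -1, and the added endpoint \<open>1/2\<close> is a null
  set.\<close>

lemma nn_integral_circle:
  assumes f: "(\<lambda>x. f (to_circle x)) \<in> borel_measurable borel"
  shows "nn_integral circle_measure f = (\<integral>\<^sup>+x\<in>{-1/2..1/2}. f (to_circle x) \<partial>lborel)"
proof -
  let ?S = "sigma UNIV {E. to_circle -` E \<in> sets lebesgue}"
  define g where "g x = f (to_circle x)" for x
  have g [measurable]: "g \<in> borel_measurable borel" using f by (simp add: g_def[abs_def])
  have S: "sets ?S = {E. to_circle -` E \<in> sets lebesgue}"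
    by (rule sigma_algebra.sets_measure_of_eq[OF sigma_algebra_circle])
  have to: "to_circle \<in> measurable (lebesgue_on {0..<1}) ?S"
    by (rule measurableI) (auto simp: S sets_restrict_space space_measure_of_conv Int_commute)
  have "f \<in> borel_measurable ?S"
    using measurable_circle[OF f] unfolding circle_measure_def by simp
  then have "nn_integral circle_measure f = (\<integral>\<^sup>+x. g x \<partial>lebesgue_on {0..<1})"
    unfolding circle_measure_def g_def using to by (intro nn_integral_distr) simp_all
  also have "\<dots> = (\<integral>\<^sup>+x\<in>{0..<1}. g x \<partial>lebesgue)"
    by (intro nn_integral_restrict_space) simp
  also have "\<dots> = (\<integral>\<^sup>+x\<in>{0..<1}. g x \<partial>lborel)"
    by (rule nn_integral_completion)
  also have "\<dots> = (\<integral>\<^sup>+x. g x * indicator {0..<1/2} x + g x * indicator {1/2..<1} x \<partial>lborel)"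
    by (intro nn_integral_cong) (auto simp: indicator_def)
  also have "\<dots> = (\<integral>\<^sup>+x\<in>{0..<1/2}. g x \<partial>lborel) + (\<integral>\<^sup>+x\<in>{1/2..<1}. g x \<partial>lborel)"
    by (intro nn_integral_add) measurable
  also have "(\<integral>\<^sup>+x\<in>{1/2..<1}. g x \<partial>lborel) =
      (\<integral>\<^sup>+x. g (1 + 1 * x) * indicator {1/2..<1} (1 + 1 * x) \<partial>lborel)"
    by (subst nn_integral_real_affine[where c=1 and t=1]) simp_all
  also have "\<dots> = (\<integral>\<^sup>+x\<in>{-1/2..<0}. g x \<partial>lborel)"
    by (intro nn_integral_cong) (auto simp: indicator_def g_def to_circle_add_1)
  also have "(\<integral>\<^sup>+x\<in>{0..<1/2}. g x \<partial>lborel) + (\<integral>\<^sup>+x\<in>{-1/2..<0}. g x \<partial>lborel)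
      = (\<integral>\<^sup>+x. g x * indicator {0..<1/2} x + g x * indicator {-1/2..<0} x \<partial>lborel)"
    by (intro nn_integral_add[symmetric]) measurable
  also have "\<dots> = (\<integral>\<^sup>+x\<in>{-1/2..1/2}. g x \<partial>lborel)"
  proof (rule nn_integral_cong_AE)
    show "AE x in lborel. g x * indicator {0..<1/2} x + g x * indicator {-1/2..<0} x
        = g x * indicator {-1/2..1/2} x"
      using AE_lborel_singleton[of "1/2::real"] by eventually_elim (auto simp: indicator_def)
  qed
  finally show ?thesis by (simp add: g_def)
qed

lemma integral_circle:
  assumes f: "(\<lambda>x. f (to_circle x)) \<in> borel_measurable borel" and nonneg: "\<And>z. 0 \<le> (f z :: real)"
  shows "(LINT z|circle_measure. f z) = (LINT x:{-1/2..1/2}|lborel. f (to_circle x))"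
proof -
  have "(LINT z|circle_measure. f z) = enn2real (\<integral>\<^sup>+z. f z \<partial>circle_measure)"
    using nonneg by (intro integral_eq_nn_integral measurable_circle f) auto
  also have "(\<integral>\<^sup>+z. f z \<partial>circle_measure) = (\<integral>\<^sup>+x\<in>{-1/2..1/2}. f (to_circle x) \<partial>lborel)"
    using f by (intro nn_integral_circle) measurable
  also have "\<dots> = (\<integral>\<^sup>+x. indicator {-1/2..1/2} x *\<^sub>R f (to_circle x) \<partial>lborel)"
    by (intro nn_integral_cong) (auto simp: indicator_def)
  also have "enn2real \<dots> = (LINT x:{-1/2..1/2}|lborel. f (to_circle x))"
    unfolding set_lebesgue_integral_def using f nonneg
    by (intro integral_eq_nn_integral[symmetric]) auto
  finally show ?thesis .
qed

section \<open>Arcs centered at 0\<close>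

definition centered_arc :: "real \<Rightarrow> circle set" where
  "centered_arc a = to_circle ` {- a / 2..a / 2}"

text \<open>Since only the measure of the set enters, the circle side becomes a function of three
  real numbers.\<close>

lemma rearrangement_eq_arc: "rearrangement M A = centered_arc (measure M A)"
  by (simp add: rearrangement_def centered_arc_def)

lemma vimage_arc: "to_circle -` centered_arc a = (\<Union>k::int. {of_int k - a/2..of_int k + a/2})"
proof (intro set_eqI iffI)
  fix x assume "x \<in> to_circle -` centered_arc a"
  then obtain y k where "y \<in> {- a/2..a/2}" "x - y = of_int k"
    by (auto simp: centered_arc_def to_circle_eq_iff elim!: Ints_cases)
  then have "x \<in> {of_int k - a/2..of_int k + a/2}" by auto
  then show "x \<in> (\<Union>k::int. {of_int k - a/2..of_int k + a/2})" by blast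
next
  fix x assume "x \<in> (\<Union>k::int. {of_int k - a/2..of_int k + a/2})"
  then obtain k :: int where "x \<in> {of_int k - a/2..of_int k + a/2}" by blast
  then have "x - of_int k \<in> {- a/2..a/2}" by auto
  moreover have "to_circle x = to_circle (x - of_int k)" by (simp add: to_circle_eq_iff)
  ultimately show "x \<in> to_circle -` centered_arc a" unfolding centered_arc_def by simp
qed

lemma to_circle_in_arc_iff: "to_circle x \<in> centered_arc a \<longleftrightarrow> (\<exists>k::int. \<bar>x - of_int k\<bar> \<le> a/2)"
proof -
  have "to_circle x \<in> centered_arc a \<longleftrightarrow> x \<in> to_circle -` centered_arc a" by simp
  also have "\<dots> \<longleftrightarrow> (\<exists>k::int. \<bar>x - of_int k\<bar> \<le> a/2)"
  proof -
    have "x \<in> {of_int k - a/2..of_int k + a/2} \<longleftrightarrow> \<bar>x - of_int k\<bar> \<le> a/2" for k :: int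
      unfolding atLeastAtMost_iff by linarith
    then show ?thesis unfolding vimage_arc by blast
  qed
  finally show ?thesis .
qed

lemma measurable_indicator_arc [measurable (raw)]:
  assumes "g \<in> borel_measurable M"
  shows "(\<lambda>x. indicator (centered_arc a) (to_circle (g x)) :: real) \<in> borel_measurable M"
proof -
  have "to_circle -` centered_arc a \<in> sets borel"
    unfolding vimage_arc by (intro sets.countable_UN') auto
  then have "(\<lambda>x. indicator (to_circle -` centered_arc a) (g x) :: real) \<in> borel_measurable M"
    by (intro measurable_compose[OF assms] borel_measurable_indicator)
  then show ?thesis by (simp only: indicator_vimage)
qed

section \<open>Convolution of two arcs and its integral over a third\<close>

definition arc_conv :: "real \<Rightarrow> real \<Rightarrow> real \<Rightarrow> real" where
  "arc_conv a b x = convolution circle_measure (indicator (centered_arc a)) (indicator (centered_arc b)) (to_circle x)"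

lemma arc_conv_eq:
  "arc_conv a b x = (LINT y:{-1/2..1/2}|lborel.
     indicator (centered_arc a) (to_circle (x - y)) * indicator (centered_arc b) (to_circle y))"
  unfolding arc_conv_def convolution_def
  by (subst integral_circle) (simp_all add: to_circle_diff)

lemma borel_measurable_arc_conv [measurable]: "arc_conv a b \<in> borel_measurable borel"
  unfolding arc_conv_eq[abs_def] set_lebesgue_integral_def
  by (intro lborel.borel_measurable_lebesgue_integral) measurable

lemma set_integrable_unit_interval:
  fixes f :: "real \<Rightarrow> real"
  assumes "f \<in> borel_measurable borel" "\<And>x. 0 \<le> f x" "\<And>x. f x \<le> 1"
  shows "set_integrable lborel {u..v} f"
proof (rule set_integrable_bound)
  show "set_integrable lborel {u..v} (\<lambda>_. 1 :: real)"
    by (auto simp: set_integrable_def emeasure_lborel_Icc_eq intro!: integrable_real_indicator)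
qed (use assms in \<open>auto simp: set_borel_measurable_def\<close>)

lemma arc_conv_nonneg: "0 \<le> arc_conv a b x"
  unfolding arc_conv_def convolution_def by (intro Bochner_Integration.integral_nonneg) simp

lemma arc_conv_le_1: "arc_conv a b x \<le> 1"
proof -
  have "arc_conv a b x \<le> (LINT y:{-1/2..1/2::real}|lborel. 1 :: real)"
    unfolding arc_conv_eq
    by (intro set_integral_mono set_integrable_unit_interval)
      (measurable, auto simp: indicator_def)
  then show ?thesis by (simp add: set_lebesgue_integral_def)
qed

text \<open>The convolution at \<open>x\<close> is the measure of the \<open>y\<close> in one arc
  with \<open>x - y\<close> in the other, and \<open>S\<close> consists of such \<open>y\<close>.
  Lower bounds suffice, as the circle is the larger side of the theorem.\<close>

lemma arc_conv_ge:
  assumes S: "S \<in> sets borel" "S \<subseteq> {-1/2..1/2}"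
    and "\<And>y. y \<in> S \<Longrightarrow> \<exists>k::int. \<bar>x - y - of_int k\<bar> \<le> a/2"
    and "\<And>y. y \<in> S \<Longrightarrow> \<exists>k::int. \<bar>y - of_int k\<bar> \<le> b/2"
  shows "measure lborel S \<le> arc_conv a b x"
proof -
  have "measure lborel S = (LINT y:{-1/2..1/2}|lborel. indicator S y)"
    using S(2) by (simp add: set_lebesgue_integral_def flip: indicator_inter_arith)
      (simp add: Int_absorb1)
  also have "\<dots> \<le> arc_conv a b x"
    unfolding arc_conv_eq
    using S(1) by (intro set_integral_mono set_integrable_unit_interval)
      (measurable, use assms in \<open>auto simp: indicator_def to_circle_in_arc_iff\<close>)
  finally show ?thesis .
qed

text \<open>The bound is the length of the intersection \<open>{u..v}\<close> of two real intervals,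
  of length \<open>b\<close> around 0 and of length \<open>a\<close> around
  \<open>x\<close>.\<close>

lemma arc_conv_ge_min:
  assumes "0 \<le> a" "0 \<le> b" "b \<le> 1"
  shows "min (min a b) ((a + b) / 2 - \<bar>x\<bar>) \<le> arc_conv a b x"
proof -
  define u where "u = max (- b / 2) (x - a / 2)"
  define v where "v = min (b / 2) (x + a / 2)"
  have "min (min a b) ((a + b) / 2 - \<bar>x\<bar>) \<le> v - u"
    using assms by (auto simp: u_def v_def min_def max_def abs_if field_simps)
  \<comment> \<open>Only an inequality, because \<open>v - u\<close> is negative when the intervals
    are disjoint.\<close>
  also have "v - u \<le> measure lborel {u..v}" by (simp add: measure_def emeasure_lborel_Icc_eq)
  also have "\<dots> \<le> arc_conv a b x"
  proof (rule arc_conv_ge)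
    have "- b / 2 \<le> u" "v \<le> b / 2" unfolding u_def v_def by linarith+
    then show "{u..v} \<subseteq> {-1/2..1/2}" using assms by auto
    fix y assume "y \<in> {u..v}"
    then have "y \<le> x + a / 2" "x - a / 2 \<le> y" "y \<le> b / 2" "- (b / 2) \<le> y"
      by (auto simp: u_def v_def)
    then have "\<bar>x - y - of_int 0\<bar> \<le> a/2" "\<bar>y - of_int 0\<bar> \<le> b/2"
      unfolding abs_le_iff by simp_all
    then show "\<exists>k::int. \<bar>x - y - of_int k\<bar> \<le> a/2" "\<exists>k::int. \<bar>y - of_int k\<bar> \<le> b/2" by blast+
  qed simp
  finally show ?thesis .
qed

text \<open>
  Near the point antipodal to 0 the arc centered at \<open>x\<close> meets the arc centered at 0 from both sides;
  \<open>G\<close> is the gap it leaves.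
\<close>

lemma arc_conv_ge_wrap:
  assumes ab: "0 \<le> a" "a \<le> 1" "0 \<le> b" "b \<le> 1"
    and x: "1 - (a + b) / 2 \<le> \<bar>x\<bar>" "\<bar>x\<bar> \<le> 1/2"
  shows "a + b - 1 \<le> arc_conv a b x"
proof -
  \<comment> \<open>The gap lies between the interval around \<open>x\<close> and its copy shifted
    by -1 if \<open>0 \<le> x\<close>, by 1 otherwise; \<open>u\<close> is its left end and
    \<open>1 - a\<close> its length.\<close>
  define u where "u = (if 0 \<le> x then x - 1 + a / 2 else x + a / 2)"
  define G where "G = {u<..<u + (1 - a)}"
  have "b = measure lborel {- b / 2..b / 2}" using ab by (simp add: measure_def)
  also have "\<dots> \<le> measure lborel (({- b / 2..b / 2} - G) \<union> G)"
    unfolding G_def using ab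
    by (intro measure_mono_fmeasurable fmeasurable.Un fmeasurable.Diff fmeasurableI)
      (auto simp: emeasure_lborel_Icc_eq)
  also have "\<dots> \<le> measure lborel ({- b / 2..b / 2} - G) + measure lborel G"
    by (intro measure_Un_le) (auto simp: G_def)
  also have "measure lborel G = 1 - a" using ab by (simp add: G_def measure_def)
  also have "measure lborel ({- b / 2..b / 2} - G) \<le> arc_conv a b x"
  proof (rule arc_conv_ge)
    fix y assume y: "y \<in> {- b / 2..b / 2} - G"
    then have y': "- (b / 2) \<le> y" "y \<le> b / 2" by auto
    then have "\<bar>y - of_int 0\<bar> \<le> b/2" by (simp add: abs_le_iff)
    then show "\<exists>k::int. \<bar>y - of_int k\<bar> \<le> b/2" by blast
    have "y \<le> u \<or> u + (1 - a) \<le> y" using y by (auto simp: G_def)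
    then show "\<exists>k::int. \<bar>x - y - of_int k\<bar> \<le> a/2"
    proof (cases "0 \<le> x")
      case True
      then have "y \<le> u \<Longrightarrow> \<bar>x - y - of_int 1\<bar> \<le> a/2"
        "u + (1 - a) \<le> y \<Longrightarrow> \<bar>x - y - of_int 0\<bar> \<le> a/2"
        using y' x ab unfolding u_def abs_le_iff by (simp_all add: field_simps)
      then show ?thesis using \<open>y \<le> u \<or> u + (1 - a) \<le> y\<close> by blast
    next
      case False
      then have "y \<le> u \<Longrightarrow> \<bar>x - y - of_int 0\<bar> \<le> a/2"
        "u + (1 - a) \<le> y \<Longrightarrow> \<bar>x - y - of_int (-1)\<bar> \<le> a/2"
        using y' x ab unfolding u_def abs_le_iff by (simp_all add: field_simps)
      then show ?thesis using \<open>y \<le> u \<or> u + (1 - a) \<le> y\<close> by blast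
    qed
  qed (use ab in \<open>auto simp: G_def\<close>)
  finally show ?thesis by simp
qed

text \<open>The comparison profile is half a trapezoid: a plateau of height \<open>h\<close>, a
  slope of gradient -1, then a floor of height \<open>w\<close>.\<close>

lemma integral_ge_pieces:
  fixes f :: "real \<Rightarrow> real"
  assumes f: "f integrable_on {0..r}" and qsr: "0 \<le> q" "q \<le> s" "s \<le> r"
    and 1: "\<And>x. 0 \<le> x \<Longrightarrow> x \<le> q \<Longrightarrow> h \<le> f x"
    and 2: "\<And>x. q \<le> x \<Longrightarrow> x \<le> s \<Longrightarrow> p - x \<le> f x"
    and 3: "\<And>x. s \<le> x \<Longrightarrow> x \<le> r \<Longrightarrow> w \<le> f x"
  shows "h * q + (p * (s - q) - (s\<^sup>2 - q\<^sup>2) / 2) + w * (r - s) \<le> integral {0..r} f"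
proof -
  have int: "f integrable_on {u..v}" if "0 \<le> u" "v \<le> r" for u v
    using f by (rule integrable_on_subinterval) (use that in auto)
  have "((\<lambda>x. p - x) has_integral (p * s - s\<^sup>2 / 2) - (p * q - q\<^sup>2 / 2)) {q..s}"
    using qsr by (intro fundamental_theorem_of_calculus)
      (auto intro!: derivative_eq_intros simp: has_real_derivative_iff_has_vector_derivative[symmetric])
  then have "(p * s - s\<^sup>2 / 2) - (p * q - q\<^sup>2 / 2) \<le> integral {q..s} f"
    by (rule has_integral_le[OF _ integrable_integral]) (use qsr 2 in \<open>auto intro!: int\<close>)
  moreover have "h * q \<le> integral {0..q} f"
    using has_integral_le[OF has_integral_const_real[of h 0 q] integrable_integral[OF int[of 0 q]]] qsr 1
    by (simp add: mult.commute)
  moreover have "w * (r - s) \<le> integral {s..r} f"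
    using has_integral_le[OF has_integral_const_real[of w s r] integrable_integral[OF int[of s r]]] qsr 3
    by (simp add: mult.commute)
  moreover have "integral {0..q} f + integral {q..s} f + integral {s..r} f = integral {0..r} f"
    using Henstock_Kurzweil_Integration.integral_combine[of 0 q s f]
      Henstock_Kurzweil_Integration.integral_combine[of 0 s r f] qsr f
    by (simp add: int)
  ultimately show ?thesis by (simp add: algebra_simps diff_divide_distrib)
qed

definition arc_triple :: "real \<Rightarrow> real \<Rightarrow> real \<Rightarrow> real" where
  "arc_triple a b c = (LINT z:centered_arc c|circle_measure.
     convolution circle_measure (indicator (centered_arc a)) (indicator (centered_arc b)) z)"

text \<open>The profile bound is applied on \<open>{0..c/2}\<close> both to the convolution and to
  its reflection, which doubles the integral.\<close>

lemma arc_triple_ge: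
  assumes c: "0 \<le> c" "c \<le> 1" and qs: "0 \<le> q" "q \<le> s" "s \<le> c / 2"
    and 1: "\<And>x. \<bar>x\<bar> \<le> q \<Longrightarrow> h \<le> arc_conv a b x"
    and 2: "\<And>x. q \<le> \<bar>x\<bar> \<Longrightarrow> \<bar>x\<bar> \<le> s \<Longrightarrow> p - \<bar>x\<bar> \<le> arc_conv a b x"
    and 3: "\<And>x. s \<le> \<bar>x\<bar> \<Longrightarrow> \<bar>x\<bar> \<le> c/2 \<Longrightarrow> w \<le> arc_conv a b x"
  shows "2 * h * q + (2 * p * (s - q) - (s\<^sup>2 - q\<^sup>2)) + w * (c - 2 * s) \<le> arc_triple a b c"
proof -
  let ?f = "arc_conv a b"
  have si: "set_integrable lborel {u..v} ?f" for u v
    by (intro set_integrable_unit_interval arc_conv_nonneg arc_conv_le_1) measurable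
  have int: "?f integrable_on {u..v}" for u v
    using si by (rule set_borel_integral_eq_integral)
  have int': "(\<lambda>x. ?f (- x)) integrable_on {0..c/2}"
    using int[of "- (c/2)" 0] Henstock_Kurzweil_Integration.integrable_reflect_real[of ?f 0 "- (c/2)"]
    by simp
  define L where "L = h * q + (p * (s - q) - (s\<^sup>2 - q\<^sup>2) / 2) + w * (c/2 - s)"
  have "L \<le> integral {0..c/2} ?f"
    unfolding L_def
  proof (rule integral_ge_pieces[OF int qs])
    show "p - x \<le> ?f x" if "q \<le> x" "x \<le> s" for x
      using 2[of x] that qs by simp
  qed (use qs in \<open>auto intro!: 1 3\<close>)
  moreover have "L \<le> integral {0..c/2} (\<lambda>x. ?f (- x))"
    unfolding L_def
  proof (rule integral_ge_pieces[OF int' qs])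
    show "p - x \<le> ?f (- x)" if "q \<le> x" "x \<le> s" for x
      using 2[of "- x"] that qs by simp
  qed (use qs in \<open>auto intro!: 1 3\<close>)
  moreover have "integral {0..c/2} (\<lambda>x. ?f (- x)) = integral {- (c/2)..0} ?f"
    using Henstock_Kurzweil_Integration.integral_reflect_real[of 0 "- (c/2)" ?f] by simp
  moreover have "integral {- (c/2)..0} ?f + integral {0..c/2} ?f = integral {- (c/2)..c/2} ?f"
    using c by (intro Henstock_Kurzweil_Integration.integral_combine int) auto
  ultimately have "2 * L \<le> integral {- (c/2)..c/2} ?f" by linarith
  also have "\<dots> = (LINT x:{- (c/2)..c/2}|lborel. ?f x)"
    by (rule set_borel_integral_eq_integral(2)[OF si, symmetric])
  also have "\<dots> = (LINT x:{-1/2..1/2}|lborel. indicator {- (c/2)..c/2} x * ?f x)"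
    using c unfolding set_lebesgue_integral_def
    by (intro Bochner_Integration.integral_cong) (auto simp: indicator_def)
  \<comment> \<open>The interval maps into the arc, and the integrand is nonnegative.\<close>
  also have "\<dots> \<le> (LINT x:{-1/2..1/2}|lborel. indicator (centered_arc c) (to_circle x) * ?f x)"
  proof (intro set_integral_mono set_integrable_unit_interval)
    fix x
    have "x \<in> {- (c/2)..c/2} \<Longrightarrow> to_circle x \<in> centered_arc c" by (simp add: centered_arc_def)
    then show "indicator {- (c/2)..c/2} x * ?f x \<le> indicator (centered_arc c) (to_circle x) * ?f x"
      by (auto simp: indicator_def arc_conv_nonneg)
    show "(\<lambda>x. indicator {- (c/2)..c/2} x * ?f x) \<in> borel_measurable borel"
      "(\<lambda>x. indicator (centered_arc c) (to_circle x) * ?f x) \<in> borel_measurable borel"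
      by measurable
  qed (auto simp: indicator_def arc_conv_nonneg arc_conv_le_1)
  also have "\<dots> = arc_triple a b c"
  proof -
    have "(\<lambda>x. indicator (centered_arc c) (to_circle x) * ?f x) \<in> borel_measurable borel"
      by measurable
    moreover have "0 \<le> convolution circle_measure (indicator (centered_arc a))
        (indicator (centered_arc b)) z" for z :: circle
      unfolding convolution_def by (intro Bochner_Integration.integral_nonneg) simp
    ultimately show ?thesis
      unfolding arc_triple_def set_lebesgue_integral_def[of circle_measure] arc_conv_def
      by (subst integral_circle) simp_all
  qed
  finally show ?thesis by (simp add: L_def field_simps)
qed

lemma arc_triple_bounds:
  assumes ab: "0 \<le> a" "a \<le> 1" "0 \<le> b" "b \<le> 1" and c: "0 \<le> c" "c \<le> 1"
  shows "c \<le> \<bar>a - b\<bar> \<Longrightarrow> min a b * c \<le> arc_triple a b c"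
    and "a + b \<le> c \<Longrightarrow> a * b \<le> arc_triple a b c"
    and "\<bar>a - b\<bar> \<le> c \<Longrightarrow> c \<le> a + b \<Longrightarrow> a * b - ((a + b - c) / 2)\<^sup>2 \<le> arc_triple a b c"
    and "2 \<le> a + b + c \<Longrightarrow> a * b - (1 - c) * (a + b - 1) \<le> arc_triple a b c"
proof -
  \<comment> \<open>The plateau of height \<open>min a b\<close> ends at
    \<open>\<bar>x\<bar> = q\<close>, and the slope reaches 0 at \<open>\<bar>x\<bar> = p\<close>.
    The four bounds differ in where \<open>c/2\<close> lies and whether the arcs wrap
    around.\<close>
  define p q where "p = (a + b) / 2" and "q = \<bar>a - b\<bar> / 2"
  have sum_eq: "a + b = 2 * p" by (simp add: p_def)
  have min_eq: "min a b = p - q" by (auto simp: p_def q_def min_def abs_if field_simps)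
  have ab_eq: "a * b = p\<^sup>2 - q\<^sup>2" by (simp add: p_def q_def power2_eq_square field_simps)
  have lower: "min (p - q) (p - \<bar>x\<bar>) \<le> arc_conv a b x" for x
    using arc_conv_ge_min[OF ab(1,3,4), of x] unfolding min_eq sum_eq by simp
  have flat: "min a b \<le> arc_conv a b x" if "\<bar>x\<bar> \<le> q" for x
    using lower[of x] that by (simp add: min_eq)
  have slope: "p - \<bar>x\<bar> \<le> arc_conv a b x" if "q \<le> \<bar>x\<bar>" for x
    using lower[of x] that by linarith
  have q: "0 \<le> q" "q \<le> p" using ab by (auto simp: p_def q_def abs_if)
  show "min a b * c \<le> arc_triple a b c" if "c \<le> \<bar>a - b\<bar>"
  proof -
    \<comment> \<open>The third arc stays on the plateau; slope and floor shrink to the endpoint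
      \<open>c/2\<close>, where 0 for \<open>p\<close> and \<open>w\<close> is a trivial
      choice.\<close>
    have "2 * min a b * (c/2) + (2 * 0 * (c/2 - c/2) - ((c/2)\<^sup>2 - (c/2)\<^sup>2)) + 0 * (c - 2 * (c/2))
        \<le> arc_triple a b c"
    proof (rule arc_triple_ge[OF c])
      show "min a b \<le> arc_conv a b x" if "\<bar>x\<bar> \<le> c/2" for x
        using \<open>c \<le> \<bar>a - b\<bar>\<close> by (intro flat order_trans[OF that]) (simp add: q_def)
      show "0 - \<bar>x\<bar> \<le> arc_conv a b x" for x
        by (rule order_trans[OF _ arc_conv_nonneg]) simp
    qed (use c in \<open>auto simp: arc_conv_nonneg\<close>)
    then show ?thesis by simp
  qed
  show "a * b \<le> arc_triple a b c" if "a + b \<le> c"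
  proof -
    \<comment> \<open>The third arc contains the whole trapezoid, whose slope ends at
      \<open>p\<close>.\<close>
    have "2 * min a b * q + (2 * p * (p - q) - (p\<^sup>2 - q\<^sup>2)) + 0 * (c - 2 * p)
        \<le> arc_triple a b c"
      using that by (intro arc_triple_ge c q flat slope arc_conv_nonneg) (simp_all add: p_def q_def)
    then show ?thesis unfolding min_eq ab_eq by (simp add: power2_eq_square field_simps)
  qed
  show "a * b - ((a + b - c) / 2)\<^sup>2 \<le> arc_triple a b c" if "\<bar>a - b\<bar> \<le> c" "c \<le> a + b"
  proof -
    \<comment> \<open>The third arc ends on the slope; the two missing triangles account for the
      square.\<close>
    have "2 * min a b * q + (2 * p * (c/2 - q) - ((c/2)\<^sup>2 - q\<^sup>2)) + 0 * (c - 2 * (c/2))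
        \<le> arc_triple a b c"
      using that by (intro arc_triple_ge c q flat slope arc_conv_nonneg) (simp_all add: p_def q_def)
    then show ?thesis unfolding min_eq ab_eq sum_eq by (simp add: power2_eq_square field_simps)
  qed
  show "a * b - (1 - c) * (a + b - 1) \<le> arc_triple a b c" if "2 \<le> a + b + c"
  proof -
    \<comment> \<open>At \<open>\<bar>x\<bar> = 1 - p\<close> the slope has come down to
      \<open>a + b - 1\<close>, the floor caused by wrapping around.\<close>
    have "2 * min a b * q + (2 * p * ((1 - p) - q) - ((1 - p)\<^sup>2 - q\<^sup>2))
        + (a + b - 1) * (c - 2 * (1 - p)) \<le> arc_triple a b c"
    proof (rule arc_triple_ge[OF c q(1)])
      show "q \<le> 1 - p" using ab by (auto simp: p_def q_def abs_if field_simps)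
      show "1 - p \<le> c/2" using that by (simp add: p_def field_simps)
      show "a + b - 1 \<le> arc_conv a b x" if "1 - p \<le> \<bar>x\<bar>" "\<bar>x\<bar> \<le> c/2" for x
        using that c by (intro arc_conv_ge_wrap ab) (auto simp: p_def)
    qed (auto intro: flat slope)
    then show ?thesis unfolding min_eq ab_eq sum_eq by (simp add: power2_eq_square field_simps)
  qed
qed

section \<open>Null sets and the inequality\<close>

text \<open>\<open>T\<close> is \<open>T0 - N\<close> together with a subset of the null set
  \<open>N\<close>. Bounding both differences by a null set is a form stable under the intersections
  and translations in a convolution.\<close>

lemma completion_null_diff:
  assumes "T0 \<in> sets M" "N \<in> null_sets M" "T - T0 \<subseteq> N" "T0 - T \<subseteq> N"
  shows "T \<in> sets (completion M)" "emeasure (completion M) T = emeasure M T0"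
proof -
  have eq: "T = (T0 - N) \<union> (T \<inter> N)" using assms(3,4) by blast
  have null: "T \<inter> N \<in> null_sets (completion M)"
    by (rule null_sets_completion_subset[OF _ null_sets_completionI[OF assms(2)]]) auto
  have Diff: "T0 - N \<in> sets M" using assms(1,2) by auto
  show "T \<in> sets (completion M)"
    by (subst eq) (use null Diff in auto)
  have "emeasure (completion M) T = emeasure (completion M) (T0 - N)"
    by (subst eq, rule emeasure_Un_null_set) (use null Diff in auto)
  also have "\<dots> = emeasure M T0"
    using assms(1,2) Diff by (simp add: emeasure_Diff_null_set)
  finally show "emeasure (completion M) T = emeasure M T0" .
qed

lemma completion_null_diffE:
  assumes "T \<in> sets (completion M)"
  obtains T0 N where "T0 \<in> sets M" "N \<in> null_sets M" "T - T0 \<subseteq> N" "T0 - T \<subseteq> N"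
proof -
  obtain S N N' where "T = S \<union> N" "N \<subseteq> N'" "N' \<in> null_sets M" "S \<in> sets M"
    using sets_completionE[OF assms] by blast
  then show thesis by (intro that[of S N']) auto
qed

context compact_group_measure
begin

lemma null_sets_reflect_translate:
  assumes "N \<in> null_sets M"
  shows "(+) x ` uminus ` N \<in> null_sets M"
proof -
  have N: "N \<in> sets borel" "measure M N = 0"
    using assms by (auto simp: null_sets_def measure_def)
  then have "measure M ((+) x ` uminus ` N) = 0"
    by (simp only: measure_translate measure_uminus borel_uminus)
  then show ?thesis
    using N by (auto simp: null_sets_def emeasure_eq_measure)
qed

text \<open>The integrand is the indicator of \<open>B\<close> intersected with
  \<open>x + (-A)\<close>. Changing \<open>A\<close> and \<open>B\<close> by null sets changes this
  set by a null set for each \<open>x\<close>, so equality holds everywhere.\<close>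

lemma convolution_completion:
  assumes "A0 \<in> sets borel" "N \<in> null_sets M" "A - A0 \<subseteq> N" "A0 - A \<subseteq> N"
    and "B0 \<in> sets borel" "N' \<in> null_sets M" "B - B0 \<subseteq> N'" "B0 - B \<subseteq> N'"
  shows "convolution (completion M) (indicator A) (indicator B) x = overlap (uminus ` A0) B0 x"
proof -
  let ?r = "\<lambda>E. (+) x ` uminus ` E"
  let ?T = "B \<inter> ?r A" and ?S = "B0 \<inter> ?r A0"
  have r: "y \<in> ?r E \<longleftrightarrow> x - y \<in> E" for y E
    by (auto simp: image_plus_eq_vimage image_uminus_eq_vimage)
  have T0: "?S \<in> sets M"
    using assms(1,5) by (auto intro!: sets.Int borel_translate borel_uminus)
  have null: "N' \<union> ?r N \<in> null_sets M"
    using assms(2,6) null_sets_reflect_translate by blast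
  have "?T - ?S \<subseteq> N' \<union> ?r N" "?S - ?T \<subseteq> N' \<union> ?r N"
    using assms(3,4,7,8) r by blast+
  note T = completion_null_diff[OF T0 null this]
  have "convolution (completion M) (indicator A) (indicator B) x
      = (LINT y|completion M. indicator ?T y)"
    unfolding convolution_def
    by (intro Bochner_Integration.integral_cong refl) (auto simp: indicator_def r)
  also have "\<dots> = measure (completion M) ?T" using T(1) by simp
  also have "\<dots> = measure M ?S" using T(2) by (simp add: measure_def)
  finally show ?thesis by (simp add: overlap_def)
qed

lemma riesz_sobolev:
  assumes conn: "connected (UNIV :: 'a set)"
    and A: "A \<in> sets (completion M)" and B: "B \<in> sets (completion M)"
    and C: "C \<in> sets (completion M)"
  shows "(LINT x:C|completion M. convolution (completion M) (indicator A) (indicator B) x)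
    \<le> arc_triple (measure (completion M) A) (measure (completion M) B) (measure (completion M) C)"
proof -
  obtain A0 NA where A0: "A0 \<in> sets borel" "NA \<in> null_sets M" "A - A0 \<subseteq> NA" "A0 - A \<subseteq> NA"
    using completion_null_diffE[OF A] by auto
  obtain B0 NB where B0: "B0 \<in> sets borel" "NB \<in> null_sets M" "B - B0 \<subseteq> NB" "B0 - B \<subseteq> NB"
    using completion_null_diffE[OF B] by auto
  obtain C0 NC where C0: "C0 \<in> sets borel" "NC \<in> null_sets M" "C - C0 \<subseteq> NC" "C0 - C \<subseteq> NC"
    using completion_null_diffE[OF C] by auto
  \<comment> \<open>The reflection undoes the one built into \<open>overlap\<close>; reflection
    invariance keeps the measure.\<close>
  let ?A = "uminus ` A0"
  have A': "?A \<in> sets borel" using A0(1) by simp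
  define a b c where "a = measure M ?A" and "b = measure M B0" and "c = measure M C0"
  have meas: "measure (completion M) A = a" "measure (completion M) B = b"
      "measure (completion M) C = c"
    using completion_null_diff(2)[of A0 M NA A] completion_null_diff(2)[of B0 M NB B]
      completion_null_diff(2)[of C0 M NC C] A0 B0 C0
    by (simp_all add: a_def b_def c_def measure_def[of "completion M"])
      (simp_all add: measure_def)
  define I where "I = (LINT x|M. indicator C0 x * overlap ?A B0 x)"
  have m: "(\<lambda>x. indicator C0 x * overlap ?A B0 x) \<in> borel_measurable M"
    using overlap_measurable[OF A' B0(1)] C0(1)
    by (intro borel_measurable_times borel_measurable_indicator)
      (simp_all add: measurable_cong_sets[OF sets_M refl])
  have "(LINT x:C|completion M. convolution (completion M) (indicator A) (indicator B) x)
      = (LINT x|completion M. indicator C x * overlap ?A B0 x)"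
    by (simp add: set_lebesgue_integral_def convolution_completion[OF A0 B0])
  also have "\<dots> = (LINT x|completion M. indicator C0 x * overlap ?A B0 x)"
  proof (rule integral_cong_AE)
    have "overlap ?A B0 \<in> borel_measurable (completion M)"
      using overlap_measurable[OF A' B0(1)]
      by (intro measurable_completion) (simp add: measurable_cong_sets[OF sets_M refl])
    then show "(\<lambda>x. indicator C x * overlap ?A B0 x) \<in> borel_measurable (completion M)"
      using C by (intro borel_measurable_times borel_measurable_indicator)
    show "(\<lambda>x. indicator C0 x * overlap ?A B0 x) \<in> borel_measurable (completion M)"
      by (intro measurable_completion m)
    have "AE x in completion M. x \<notin> NC"
      using AE_not_in[OF C0(2)] by (rule AE_completion)
    then show "AE x in completion M. indicator C x * overlap ?A B0 x = indicator C0 x * overlap ?A B0 x"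
      by eventually_elim (use C0(3,4) in \<open>auto simp: indicator_def\<close>)
  qed
  also have "\<dots> = I" unfolding I_def by (rule integral_completion[OF m])
  finally have lhs: "(LINT x:C|completion M. convolution (completion M) (indicator A) (indicator B) x) = I" .
  note up = integral_indicator_overlap_bounds[OF A' B0(1) C0(1), folded I_def a_def b_def c_def]
  have ab: "0 \<le> a" "a \<le> 1" "0 \<le> b" "b \<le> 1" and c: "0 \<le> c" "c \<le> 1"
    by (simp_all add: a_def b_def c_def)
  note low = arc_triple_bounds[OF ab c]
  have "I \<le> arc_triple a b c"
  proof -
    \<comment> \<open>In the first three cases elementary bounds match the arcs; connectedness is
      used in the last.\<close>
    consider "c \<le> \<bar>a - b\<bar>" | "a + b \<le> c" | "2 \<le> a + b + c"
      | "\<bar>a - b\<bar> < c" "c < a + b" "a + b + c < 2" by linarith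
    then show ?thesis
    proof cases
      case 1
      have "I \<le> min a b * c" using up(1,2) by (simp add: min_def)
      then show ?thesis using low(1)[OF 1] by linarith
    next
      case 2
      show ?thesis using up(3) low(2)[OF 2] by linarith
    next
      case 3
      show ?thesis using up(4) low(4)[OF 3] by linarith
    next
      case 4
      \<comment> \<open>The strict inequalities of this case give, in terms of \<open>t\<close>,
        exactly the side conditions of the truncation bound; \<open>a + b + c < 2\<close> gives
        \<open>a + b - t \<le> 1\<close>.\<close>
      define t where "t = (a + b - c) / 2"
      have c_eq: "c = a + b - 2 * t" by (simp add: t_def field_simps)
      then have t: "0 < t" "t < a" "t < b" "a + b - t \<le> 1" using 4 by linarith+
      have "I \<le> t * c + a * b - t * (a + b - t)" by (rule up(5)[OF conn t])
      also have "\<dots> = a * b - t\<^sup>2" unfolding c_eq by (simp add: power2_eq_square algebra_simps)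
      also have "\<dots> \<le> arc_triple a b c"
        unfolding t_def using 4 by (intro low(3)) auto
      finally show ?thesis .
    qed
  qed
  then show ?thesis unfolding lhs meas .
qed

end

theorem theorem1p1:
  fixes \<mu> :: "'a::{topological_ab_group_add, t2_space} measure"
    and A B C :: "'a set"
  assumes "compact (UNIV :: 'a set)"
    and "connected (UNIV :: 'a set)"
    and "haar_measure \<mu>"
    and "emeasure \<mu> UNIV = 1"
    and "A \<in> sets \<mu>" and "B \<in> sets \<mu>" and "C \<in> sets \<mu>"
  shows "(LINT x:C|\<mu>. convolution \<mu> (indicator A) (indicator B) x)
    \<le> (LINT t:rearrangement \<mu> C|circle_measure.
          convolution circle_measure
            (indicator (rearrangement \<mu> A)) (indicator (rearrangement \<mu> B)) t)"
proof -
  obtain \<nu> where \<nu>: "radon_measure \<nu>" "\<mu> = completion \<nu>"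
    "\<And>x E. E \<in> sets borel \<Longrightarrow> emeasure \<nu> ((+) x ` E) = emeasure \<nu> E"
    using assms(3) unfolding haar_measure_def by blast
  have sets: "sets \<nu> = sets borel" using \<nu>(1) by (simp add: radon_measure_def)
  have one: "emeasure \<nu> UNIV = 1" using assms(4) \<nu>(2) sets by simp
  interpret prob_space \<nu>
    by (rule prob_spaceI) (use one sets_eq_imp_space_eq[OF sets] in simp)
  interpret compact_group_measure \<nu>
  proof
    show "emeasure \<nu> E = (INF U\<in>{U. open U \<and> E \<subseteq> U}. emeasure \<nu> U)" if "E \<in> sets borel" for E
      using \<nu>(1) that by (simp add: radon_measure_def)
  qed (fact assms(1) sets \<nu>(3))+
  show ?thesis
    using riesz_sobolev[OF assms(2) assms(5-7)[unfolded \<nu>(2)]]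
    unfolding \<nu>(2) rearrangement_eq_arc arc_triple_def .
qed

end
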